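(* Let $R$ be a Gorenstein local (or graded) ring with infinite residue field and $\frac12\in R$, let $\mathbb A$ be the minimal free resolution of a perfect $R$-module $M$, of format $(2,r_1,r_2,r_3)$ equal to $(2,6,5,1)$ or $(2,5,5,2)$, and let $\mathbb D$ be the free resolution of a module $M'$ minimally BR-linked to $M$ by means of the first four columns of $a_1$ (with the bases given in the context). Put $\varepsilon=e_1\wedge e_2\wedge e_3\wedge e_4$, $\sigma=s_1\wedge s_2\wedge s_3\wedge s_4$. Some entries of the maps $w^{(3)}_{2,1}:\bigwedge^5D_1\otimes D_1\to D_2\otimes D_3$ and $w^{(3)}_{2,2}:\bigwedge^6D_1\to D_2\otimes D_3$ of $\mathbb D$ are described as follows (right-hand sides are maps of $\mathbb A$): $$w^{(3)}_{2,1}(\sigma\wedge\gamma_1\otimes s_1)=\sum_{k=5}^{r_1}\sum_{h=1}^{r_2}\langle w^{(2)}_1(e_k\wedge e_1\otimes f_h),\gamma_1\rangle\,(\epsilon_k\otimes\phi_h),$$ $$w^{(3)}_{2,1}(\sigma\wedge\gamma_1\otimes\gamma_1)=\sum_{k=5}^{r_1}\sum_{h=1}^{r_2}\langle w^{(2)}_{2,2}(\varepsilon\wedge e_k\otimes f_h),\gamma_1\otimes\gamma_1\rangle\,(\epsilon_k\otimes\phi_h),$$ $$w^{(3)}_{2,2}(\sigma\wedge\gamma_1\wedge\gamma_2)=\sum_{k=5}^{r_1}\sum_{h=1}^{r_2}\langle w^{(2)}_{2,1}(\varepsilon\otimes e_k\otimes f_h),\gamma_1\wedge\gamma_2\rangle\,(\epsilon_k\otimes\phi_h).$$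 The same formulas hold for all the analogous combinations of basis elements $\gamma_t$ and $s_j$. (The last formula concerns the case $r_3=2$.)
   Context: A module is perfect if its projective dimension equals the grade of its annihilator. The format of $0\to F_3\to F_2\to F_1\to F_0$ is the sequence of ranks $(r_0,r_1,r_2,r_3)$. Structure maps. Let $\mathbb F:0\to F_3\xrightarrow{d_3}F_2\xrightarrow{d_2}F_1\xrightarrow{d_1}F_0$ be a free resolution, $F_0=R^2$ with basis $u_1,u_2$; $e_i$, $f_h$ bases of $F_1$, $F_2$. $m_{ij}$ is the $2\times2$ minor of $d_1$ on columns $i,j$ ($m_{ji}=-m_{ij}$). Identify $\bigwedge^2F_0=R$ by $u_1\wedge u_2=1$, and for $v\in F_0$, $c=\sum_ju_j\otimes g_j\in F_0\otimes F_3$ put $v\wedge c=\sum_j(v\wedge u_j)g_j\in F_3$ and $c\wedge v=-v\wedge c$. The maps are obtained by lifting the indicated elements; when a lift is not unique some choice is fixed. Formulas are written for one choice of indices; the other entries are defined analogously, respecting skew-symmetry. Write $e_ie_je_k:=w^{(3)}_1(e_i\wedge e_j\wedge e_k)$, $\varepsilon_{1,\dots,i}=e_1\wedge\dots\wedge e_i$, hats denoting omission; tensor factors are reordered freely. - $w^{(3)}_1:\bigwedge^3F_1\to F_2$: $d_2(e_ie_je_k)=m_{ij}e_k-m_{ik}e_j+m_{jk}e_i$. - $w^{(2)}_1:\bigwedge^2F_1\otimes F_2\to F_3$: $d_3w^{(2)}_1(e_i\wedge e_j\otimes f_h)=m_{ij}f_h-w^{(3)}_1(d_2(f_h)\wedge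 e_i\wedge e_j)$. - $w^{(1)}_1:\bigwedge^4F_1\to F_0\otimes F_3$: $(1\otimes d_3)w^{(1)}_1(\varepsilon_{1,2,3,4})=\sum_{j=1}^4(-1)^{j+1}d_1(e_j)\otimes w^{(3)}_1(\varepsilon_{1,\dots,\hat j,\dots,4})$. - $w^{(3)}_{2,1}:\bigwedge^5F_1\otimes F_1\to F_2\otimes F_3$ and $w^{(3)}_{2,2}:\bigwedge^6F_1\to F_2\otimes F_3$ (the latter zero if $r_1=5$) are lifts along the map $F_3\otimes F_2\to S_2F_2$ induced by $d_3$: $w^{(3)}_{2,1}(\varepsilon_{1,\dots,5}\otimes e_1)$ lifts $e_1e_2e_3\otimes e_1e_4e_5-e_1e_2e_4\otimes e_1e_3e_5+e_1e_2e_5\otimes e_1e_3e_4$, and $w^{(3)}_{2,2}(\varepsilon_{1,\dots,6})$ lifts $\sum_{1\le i<j\le5}(-1)^{i+j+1}e_ie_je_6\otimes w^{(3)}_1(\varepsilon_{1,\dots,\hat i,\hat j,\dots,5})$, both seen as elements of $S_2F_2$. - $w^{(2)}_{2,1}:\bigwedge^4F_1\otimes F_1\otimes F_2\to\bigwedge^2F_3$, lifted along $\bigwedge^2F_3\to F_3\otimes F_2$, $a\wedge b\mapsto d_3(a)\otimes b-a\otimes d_3(b)$. There are two formulas, depending on the configuration of the basis elements (equivalent up to multiplying by a constant): $w^{(2)}_{2,1}(\varepsilon_{1,2,3,4}\otimes e_1\otimes f_h)$ lifts $e_1e_2e_3\otimes w^{(2)}_1(e_1\wedge e_4\otimes f_h)-e_1e_2e_4\otimes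 w^{(2)}_1(e_1\wedge e_3\otimes f_h)+e_1e_3e_4\otimes w^{(2)}_1(e_1\wedge e_2\otimes f_h)+f_h\otimes d_1(e_1)\wedge w^{(1)}_1(\varepsilon_{1,2,3,4})-w^{(3)}_{2,1}(\varepsilon_{1,2,3,4}\wedge d_2(f_h)\otimes e_1)$; and $w^{(2)}_{2,1}(\varepsilon_{1,2,3,4}\otimes e_5\otimes f_h)$ lifts $\sum_{1\le i<j\le4}(-1)^{i+j+1}w^{(2)}_1(\varepsilon_{1,\dots,\hat i,\hat j,\dots,4}\otimes f_h)\otimes e_ie_je_5+\sum_{1\le i\le4}(-1)^iw^{(2)}_1(e_i\wedge e_5\otimes f_h)\otimes w^{(3)}_1(\varepsilon_{1,\dots,\hat i,\dots,4})+\frac12f_h\otimes\sum_{1\le i\le5}(-1)^iw^{(1)}_1(\varepsilon_{1,\dots,\hat i,\dots,5})\wedge d_1(e_i)-w^{(3)}_{2,1}(\varepsilon_{1,2,3,4}\wedge d_2(f_h)\otimes e_5)$. - $w^{(2)}_{2,2}:\bigwedge^5F_1\otimes F_2\to S_2F_3$: $w^{(2)}_{2,2}(\varepsilon_{1,\dots,5}\otimes f_h)$ lifts, along $S_2F_3\to F_2\otimes F_3$, $ab\mapsto d_3(a)\otimes b+d_3(b)\otimes a$, the element $\sum_{i<j<k}(-1)^{i+j+k}e_ie_je_k\otimes w^{(2)}_1(\varepsilon_{1,\dots,\hat i,\hat j,\hat k,\dots,5}\otimes f_h)+\frac12f_h\otimes\sum_i(-1)^id_1(e_i)\wedge w^{(1)}_1(\varepsilon_{1,\dots,\hat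 i,\dots,5})-w^{(3)}_{2,2}(\varepsilon_{1,\dots,5}\wedge d_2(f_h))$. The pairing of an element of $S_2F_3$ with $\gamma_t\otimes\gamma_t$ is its coefficient at $g_t\cdot g_t$. The linked complex. Let $\mathbb A:0\to A_3\xrightarrow{a_3}A_2\xrightarrow{a_2}A_1\xrightarrow{a_1}A_0$ have bases $\{e_k\}$ of $A_1$, $\{f_h\}$ of $A_2$, $\{g_t\}$ of $A_3$, dual bases $\{\epsilon_k\},\{\phi_h\},\{\gamma_t\}$ of $A_1^*,A_2^*,A_3^*$; $\langle\cdot,\cdot\rangle$ is evaluation. Let $x_{ij},y_{ij},z_{ij}$ be the entries of the matrices of $a_1,a_2,a_3$. Assume the ideal of $2\times2$ minors of the first four columns of $a_1$ has height 3. Let $\{s_1,\dots,s_4\}$ be a basis of $B_1=R^4$, $b_1(s_i)=a_1(e_i)$, and let $\mathbb B$ be the Buchsbaum--Rim complex resolving $\operatorname{coker}b_1$, with basis $\{t_1,\dots,t_4\}$ of $B_2$ and differential $b_2:B_2\to B_1$. The minimally BR-linked module $M'$ is the one resolved by $\mathbb D:0\to A_1^*\xrightarrow{d_3}A_2^*\oplus B_2\xrightarrow{d_2}A_3^*\oplus B_1\xrightarrow{d_1}D_0=A_0$, the mapping cone of the map $\mathbb A^*\to\mathbb B$, with components $\beta_i:A_i^*\to B_{3-i}$, dual (via the self-duality of $\mathbb B$) to the comparison map $\mathbb B\to\mathbb A$ lifting the identity of $A_0$ and sending $s_i\mapsto e_i$. Its differentials are $$d_1=\begin{bmatrix}\beta_3&b_1\end{bmatrix},\quad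 d_2=\begin{bmatrix}a_3^*&0\\-\beta_2&-b_2\end{bmatrix},\quad d_3=\begin{bmatrix}a_2^*\\\beta_1\end{bmatrix},$$ where $\beta_1(\epsilon_k)=t_k$ for $k\le4$ and $0$ otherwise; $\beta_2(\phi_h)=\langle e_2e_3e_4,\phi_h\rangle s_1-\langle e_1e_3e_4,\phi_h\rangle s_2+\langle e_1e_2e_4,\phi_h\rangle s_3-\langle e_1e_2e_3,\phi_h\rangle s_4$; $\beta_3(\gamma_t)=\sum_{j=1}^2\langle w^{(1)}_1(\varepsilon),\gamma_t\otimes u_j^*\rangle u_j$. The elements $\epsilon_1,\dots,\epsilon_4$ are redundant and are removed, with $t_j=\sum_hy_{jh}\phi_h$; after this, $D_1,D_2,D_3$ have bases $\{\gamma_1,\dots,\gamma_{r_3},s_1,\dots,s_4\}$, $\{\phi_1,\dots,\phi_{r_2}\}$, $\{\epsilon_5,\dots,\epsilon_{r_1}\}$. The map $w^{(3)}_1$ of $\mathbb D$ used is: $w^{(3)}_1(s_i\wedge s_j\wedge s_k)=(-1)^rt_r$ for $i<j<k$, $\{i,j,k,r\}=\{1,2,3,4\}$; $w^{(3)}_1(s_i\wedge s_j\wedge\gamma_t)=\sum_h\langle w^{(2)}_1(e_i\wedge e_j\otimes f_h),\gamma_t\rangle\phi_h$; $w^{(3)}_1(s_i\wedge\gamma_1\wedge\gamma_2)=\sum_h\langle w^{(2)}_{2,1}(\varepsilon\otimes e_i\otimes f_h),\gamma_1\wedge\gamma_2\rangle\phi_h$.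
   Formalization: The displayed lifts need not exist, so: w^(3)_{2,2} is lifted to Λ²F_2, not S_2F_2; in w^(2)_{2,1} the w^(3)_{2,1} term has sign +, and its e_5-formula is replaced by a liftable one; the triple sum in w^(2)_{2,2} changes sign. Equality means the right side is an admissible lift. *)

theory Defs
  imports
    "HOL-Algebra.Algebraic_Closure_Type"
    "HOL-Algebra.Ring_Divisibility"
    "HOL-Algebra.QuotRing"
    "HOL-Library.Extended_Nat"
begin

section \<open>Finitely generated free modules and matrices\<close>

text \<open>
  The base ring is the type \<open>'a\<close>. The free module of rank \<open>n\<close> consists of the functions supported
  on \<open>{1..n}\<close>, and a matrix is a function of a row and a column index, both counted from 1.
  Ideal-theoretic notions are those of HOL-Algebra for the ring \<open>ring_of_type_algebra\<close>.
\<close>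

type_synonym 'a mtx = "nat \<Rightarrow> nat \<Rightarrow> 'a"

definition free_mod :: "nat \<Rightarrow> (nat \<Rightarrow> 'a::comm_ring_1) set" where
  "free_mod n = {v. \<forall>i. i \<notin> {1..n} \<longrightarrow> v i = 0}"

definition mat_app :: "nat \<Rightarrow> nat \<Rightarrow> 'a::comm_ring_1 mtx \<Rightarrow> (nat \<Rightarrow> 'a) \<Rightarrow> nat \<Rightarrow> 'a" where
  "mat_app m n A v = (\<lambda>i. if i \<in> {1..m} then (\<Sum>j=1..n. A i j * v j) else 0)"

definition mat_im :: "nat \<Rightarrow> nat \<Rightarrow> 'a::comm_ring_1 mtx \<Rightarrow> (nat \<Rightarrow> 'a) set" where
  "mat_im m n A = mat_app m n A ` free_mod n"

definition mat_ker :: "nat \<Rightarrow> nat \<Rightarrow> 'a::comm_ring_1 mtx \<Rightarrow> (nat \<Rightarrow> 'a) set" where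
  "mat_ker m n A = {v \<in> free_mod n. mat_app m n A v = (\<lambda>_. 0)}"

definition mat_transpose :: "'a mtx \<Rightarrow> 'a mtx" where
  "mat_transpose A = (\<lambda>i j. A j i)"

definition minor2 :: "'a::comm_ring_1 mtx \<Rightarrow> nat \<Rightarrow> nat \<Rightarrow> 'a" where
  "minor2 x i j = x 1 i * x 2 j - x 1 j * x 2 i"


section \<open>Gorenstein local and graded rings\<close>

definition free_resolution :: "(nat \<Rightarrow> nat) \<Rightarrow> (nat \<Rightarrow> 'a::comm_ring_1 mtx) \<Rightarrow> bool" where
  "free_resolution p d \<longleftrightarrow>
     (\<forall>i. mat_ker (p i) (p (Suc i)) (d (Suc i)) = mat_im (p (Suc i)) (p (i + 2)) (d (i + 2)))"

text \<open>
  The ring has injective dimension at most \<open>n\<close> over itself iff \<open>Ext\<^sup>i(N,R) = 0\<close> for all \<open>i > n\<close> and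
  all finitely generated \<open>N\<close>. Here \<open>N\<close> is the cokernel of \<open>d 1\<close>, the map \<open>d i\<close> goes from \<open>R\<^bsup>p i\<^esup>\<close> to
  \<open>R\<^bsup>p (i-1)\<^esup>\<close>, and over a noetherian ring every finitely generated module has such a resolution.
\<close>

definition self_injdim_le :: "'a::comm_ring_1 itself \<Rightarrow> nat \<Rightarrow> bool" where
  "self_injdim_le _ n \<longleftrightarrow>
     (\<forall>p (d :: nat \<Rightarrow> 'a mtx). free_resolution p d \<longrightarrow>
       (\<forall>i>n. mat_ker (p (Suc i)) (p i) (mat_transpose (d (Suc i)))
              = mat_im (p i) (p (i - 1)) (mat_transpose (d i))))"

text \<open>
  For the noetherian local and graded rings considered below, which have finite Krull dimension,
  being Gorenstein means having finite injective dimension over itself.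
\<close>

definition gorenstein_ring :: "'a::comm_ring_1 itself \<Rightarrow> bool" where
  "gorenstein_ring T \<longleftrightarrow>
     noetherian_ring (ring_of_type_algebra :: 'a ring) \<and> (\<exists>n. self_injdim_le T n)"

definition local_ring_with :: "'a::comm_ring_1 set \<Rightarrow> bool" where
  "local_ring_with m \<longleftrightarrow> {I. maximalideal I (ring_of_type_algebra :: 'a ring)} = {m}"

text \<open>A grading by the natural numbers, given by the projections \<open>\<pi> i\<close> to the homogeneous components.\<close>

definition is_grading :: "(nat \<Rightarrow> 'a \<Rightarrow> 'a::comm_ring_1) \<Rightarrow> bool" where
  "is_grading \<pi> \<longleftrightarrow>
     (\<forall>i x y. \<pi> i (x + y) = \<pi> i x + \<pi> i y) \<and>
     (\<forall>i j x. \<pi> i (\<pi> j x) = (if i = j then \<pi> i x else 0)) \<and>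
     (\<forall>x. finite {i. \<pi> i x \<noteq> 0} \<and> x = (\<Sum>i | \<pi> i x \<noteq> 0. \<pi> i x)) \<and>
     (\<forall>i j x y. \<pi> (i + j) (\<pi> i x * \<pi> j y) = \<pi> i x * \<pi> j y)"

definition homogeneous_set :: "(nat \<Rightarrow> 'a \<Rightarrow> 'a) \<Rightarrow> 'a set \<Rightarrow> bool" where
  "homogeneous_set \<pi> I \<longleftrightarrow> (\<forall>x\<in>I. \<forall>i. \<pi> i x \<in> I)"

text \<open>
  The degree zero part is a local ring (for instance a field), and \<open>m\<close> is the homogeneous maximal
  ideal.
\<close>

definition graded_ring_with :: "(nat \<Rightarrow> 'a \<Rightarrow> 'a::comm_ring_1) \<Rightarrow> 'a set \<Rightarrow> bool" where
  "graded_ring_with \<pi> m \<longleftrightarrow>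
     is_grading \<pi> \<and>
     maximalideal m (ring_of_type_algebra :: 'a ring) \<and> homogeneous_set \<pi> m \<and>
     (\<forall>I. ideal I (ring_of_type_algebra :: 'a ring) \<and> homogeneous_set \<pi> I \<and> I \<noteq> UNIV \<longrightarrow> I \<subseteq> m)"


section \<open>Height, grade and perfect modules\<close>

definition prime_height :: "'a::comm_ring_1 set \<Rightarrow> enat" where
  "prime_height P = Sup {enat n | n Q. Q n = P \<and>
     (\<forall>i\<le>n. primeideal (Q i) (ring_of_type_algebra :: 'a ring)) \<and> (\<forall>i<n. Q i \<subset> Q (Suc i))}"

definition ideal_height :: "'a::comm_ring_1 set \<Rightarrow> enat" where
  "ideal_height I =
     Inf (prime_height ` {P. primeideal P (ring_of_type_algebra :: 'a ring) \<and> I \<subseteq> P})"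

abbreviation gen_ideal :: "'a::comm_ring_1 set \<Rightarrow> 'a set" where
  "gen_ideal S \<equiv> genideal (ring_of_type_algebra :: 'a ring) S"

definition regular_seq :: "'a::comm_ring_1 list \<Rightarrow> bool" where
  "regular_seq xs \<longleftrightarrow> gen_ideal (set xs) \<noteq> UNIV \<and>
     (\<forall>i<length xs. \<forall>c. c * xs ! i \<in> gen_ideal (set (take i xs)) \<longrightarrow> c \<in> gen_ideal (set (take i xs)))"

definition ideal_grade :: "'a::comm_ring_1 set \<Rightarrow> enat" where
  "ideal_grade I = Sup {enat (length xs) | xs. set xs \<subseteq> I \<and> regular_seq xs}"

definition ann_coker :: "nat \<Rightarrow> nat \<Rightarrow> 'a::comm_ring_1 mtx \<Rightarrow> 'a set" where
  "ann_coker a b A = {c. \<forall>v\<in>free_mod a. (\<lambda>i. c * v i) \<in> mat_im a b A}"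

definition idempotent_mtx :: "nat \<Rightarrow> 'a::comm_ring_1 mtx \<Rightarrow> bool" where
  "idempotent_mtx n E \<longleftrightarrow> (\<forall>v\<in>free_mod n. mat_app n n E (mat_app n n E v) = mat_app n n E v)"

text \<open>
  Finitely generated projective modules are the images of idempotent matrices. The following says
  that the cokernel of the \<open>a \<times> b\<close> matrix \<open>A\<close> has a resolution by such modules \<open>P i\<close>, of length at
  most \<open>n\<close>; the augmentation from \<open>P 0\<close> is induced by the matrix \<open>d 0\<close>.
\<close>

definition has_proj_resolution :: "nat \<Rightarrow> nat \<Rightarrow> 'a::comm_ring_1 mtx \<Rightarrow> nat \<Rightarrow> bool" where
  "has_proj_resolution a b A n \<longleftrightarrow>
     (\<exists>(p :: nat \<Rightarrow> nat) (E :: nat \<Rightarrow> 'a mtx) (d :: nat \<Rightarrow> 'a mtx) P.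
        (\<forall>i. idempotent_mtx (p i) (E i) \<and> P i = mat_im (p i) (p i) (E i)) \<and>
        (\<forall>i>n. P i = {\<lambda>_. 0}) \<and>
        (\<forall>u\<in>free_mod a. \<exists>v\<in>P 0. \<exists>w\<in>mat_im a b A. u = (\<lambda>i. mat_app a (p 0) (d 0) v i + w i)) \<and>
        {v \<in> P 0. mat_app a (p 0) (d 0) v \<in> mat_im a b A} = mat_app (p 0) (p 1) (d 1) ` P 1 \<and>
        (\<forall>i. {v \<in> P (Suc i). mat_app (p i) (p (Suc i)) (d (Suc i)) v = (\<lambda>_. 0)}
             = mat_app (p (Suc i)) (p (i + 2)) (d (i + 2)) ` P (i + 2)))"

definition coker_pd :: "nat \<Rightarrow> nat \<Rightarrow> 'a::comm_ring_1 mtx \<Rightarrow> enat" where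
  "coker_pd a b A = Inf (enat ` {n. has_proj_resolution a b A n})"

definition perfect_coker :: "nat \<Rightarrow> nat \<Rightarrow> 'a::comm_ring_1 mtx \<Rightarrow> bool" where
  "perfect_coker a b A \<longleftrightarrow> coker_pd a b A = ideal_grade (ann_coker a b A)"


section \<open>Complexes of length three with \<open>F\<^sub>0\<close> of rank two\<close>

record 'a complex3 =
  rk1 :: nat
  rk2 :: nat
  rk3 :: nat
  df1 :: "'a mtx"
  df2 :: "'a mtx"
  df3 :: "'a mtx"

definition acyclic3 :: "'a::comm_ring_1 complex3 \<Rightarrow> bool" where
  "acyclic3 C \<longleftrightarrow>
     mat_ker 2 (rk1 C) (df1 C) = mat_im (rk1 C) (rk2 C) (df2 C) \<and>
     mat_ker (rk1 C) (rk2 C) (df2 C) = mat_im (rk2 C) (rk3 C) (df3 C) \<and>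
     mat_ker (rk2 C) (rk3 C) (df3 C) = {\<lambda>_. 0}"

definition minimal3 :: "'a set \<Rightarrow> 'a complex3 \<Rightarrow> bool" where
  "minimal3 m C \<longleftrightarrow>
     (\<forall>i\<in>{1..2}. \<forall>j\<in>{1..rk1 C}. df1 C i j \<in> m) \<and>
     (\<forall>i\<in>{1..rk1 C}. \<forall>j\<in>{1..rk2 C}. df2 C i j \<in> m) \<and>
     (\<forall>i\<in>{1..rk2 C}. \<forall>j\<in>{1..rk3 C}. df3 C i j \<in> m)"

definition homogeneous_of :: "(nat \<Rightarrow> 'a \<Rightarrow> 'a::zero) \<Rightarrow> int \<Rightarrow> 'a \<Rightarrow> bool" where
  "homogeneous_of \<pi> k x \<longleftrightarrow> (if k < 0 then x = 0 else \<pi> (nat k) x = x)"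

text \<open>The arguments \<open>\<delta>\<close> of the existential quantifier are the degrees of the basis elements.\<close>

definition homogeneous3 :: "(nat \<Rightarrow> 'a \<Rightarrow> 'a::zero) \<Rightarrow> 'a complex3 \<Rightarrow> bool" where
  "homogeneous3 \<pi> C \<longleftrightarrow> (\<exists>\<delta>0 \<delta>1 \<delta>2 \<delta>3 :: nat \<Rightarrow> int.
     (\<forall>i\<in>{1..2}. \<forall>j\<in>{1..rk1 C}. homogeneous_of \<pi> (\<delta>1 j - \<delta>0 i) (df1 C i j)) \<and>
     (\<forall>i\<in>{1..rk1 C}. \<forall>j\<in>{1..rk2 C}. homogeneous_of \<pi> (\<delta>2 j - \<delta>1 i) (df2 C i j)) \<and>
     (\<forall>i\<in>{1..rk2 C}. \<forall>j\<in>{1..rk3 C}. homogeneous_of \<pi> (\<delta>3 j - \<delta>2 i) (df3 C i j)))"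


section \<open>Structure maps\<close>

text \<open>
  A linear map on the \<open>n\<close>-th exterior power of a free module is given by its values on the wedges
  of basis elements, that is, by an alternating function \<open>w\<close> on lists of basis indices; \<open>w xs k\<close> is
  the coefficient of the value at the basis element \<open>k\<close> of the target.
  Positions in lists are counted from 1: \<open>nth1 xs j\<close> is the \<open>j\<close>-th entry of \<open>xs\<close>, and \<open>omit J xs\<close> is
  \<open>xs\<close> with the entries at the positions in \<open>J\<close> left out.
\<close>

definition alternating :: "nat \<Rightarrow> nat \<Rightarrow> (nat list \<Rightarrow> 'x \<Rightarrow> 'a::comm_ring_1) \<Rightarrow> bool" where
  "alternating n r w \<longleftrightarrow> (\<forall>xs. length xs = n \<and> set xs \<subseteq> {1..r} \<longrightarrow>
     (\<forall>k. (\<not> distinct xs \<longrightarrow> w xs k = 0) \<and>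
          (\<forall>i<n. \<forall>j<n. i \<noteq> j \<longrightarrow> w (xs[i := xs ! j, j := xs ! i]) k = - w xs k)))"

definition nth1 :: "nat list \<Rightarrow> nat \<Rightarrow> nat" where
  "nth1 xs j = xs ! (j - 1)"

definition omit :: "nat set \<Rightarrow> nat list \<Rightarrow> nat list" where
  "omit J xs = map (nth1 xs) (filter (\<lambda>k. k \<notin> J) [1..<Suc (length xs)])"

definition wedge_args :: "nat \<Rightarrow> nat \<Rightarrow> nat list \<Rightarrow> bool" where
  "wedge_args r n xs \<longleftrightarrow> length xs = n \<and> set xs \<subseteq> {1..r} \<and> distinct xs"

text \<open>In the following, \<open>w31\<close> stands for \<open>w\<^sup>(\<^sup>3\<^sup>)\<^sub>1\<close>, \<open>w221\<close> for \<open>w\<^sup>(\<^sup>2\<^sup>)\<^sub>2\<^sub>,\<^sub>1\<close>, and so on.\<close>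

definition is_w31 :: "'a::comm_ring_1 complex3 \<Rightarrow> (nat list \<Rightarrow> nat \<Rightarrow> 'a) \<Rightarrow> bool" where
  "is_w31 C w31 \<longleftrightarrow> alternating 3 (rk1 C) w31 \<and>
     (\<forall>i\<in>{1..rk1 C}. \<forall>j\<in>{1..rk1 C}. \<forall>k\<in>{1..rk1 C}. \<forall>l\<in>{1..rk1 C}.
        (\<Sum>h=1..rk2 C. df2 C l h * w31 [i, j, k] h)
        = minor2 (df1 C) i j * of_bool (l = k) - minor2 (df1 C) i k * of_bool (l = j)
          + minor2 (df1 C) j k * of_bool (l = i))"

text \<open>\<open>w21 [i,j] h t\<close> is the coefficient at \<open>g\<^sub>t\<close> of the value at \<open>e\<^sub>i \<and> e\<^sub>j \<otimes> f\<^sub>h\<close>.\<close>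

definition is_w21 :: "'a::comm_ring_1 complex3 \<Rightarrow> (nat list \<Rightarrow> nat \<Rightarrow> 'a) \<Rightarrow>
    (nat list \<Rightarrow> nat \<Rightarrow> nat \<Rightarrow> 'a) \<Rightarrow> bool" where
  "is_w21 C w31 w21 \<longleftrightarrow>
     (\<forall>h\<in>{1..rk2 C}. alternating 2 (rk1 C) (\<lambda>xs. w21 xs h) \<and>
        (\<forall>i\<in>{1..rk1 C}. \<forall>j\<in>{1..rk1 C}. \<forall>p\<in>{1..rk2 C}.
           (\<Sum>t=1..rk3 C. df3 C p t * w21 [i, j] h t)
           = minor2 (df1 C) i j * of_bool (p = h) - (\<Sum>l=1..rk1 C. df2 C l h * w31 [l, i, j] p)))"

text \<open>\<open>w11 xs u t\<close> is the coefficient at \<open>u\<^sub>u \<otimes> g\<^sub>t\<close>.\<close>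

definition is_w11 :: "'a::comm_ring_1 complex3 \<Rightarrow> (nat list \<Rightarrow> nat \<Rightarrow> 'a) \<Rightarrow>
    (nat list \<Rightarrow> nat \<Rightarrow> nat \<Rightarrow> 'a) \<Rightarrow> bool" where
  "is_w11 C w31 w11 \<longleftrightarrow>
     (\<forall>u\<in>{1..2}. alternating 4 (rk1 C) (\<lambda>xs. w11 xs u) \<and>
        (\<forall>xs p. wedge_args (rk1 C) 4 xs \<and> p \<in> {1..rk2 C} \<longrightarrow>
           (\<Sum>t=1..rk3 C. df3 C p t * w11 xs u t)
           = (\<Sum>j=1..4. (-1) ^ (j + 1) * df1 C u (nth1 xs j) * w31 (omit {j} xs) p)))"

text \<open>The coefficient at \<open>g\<^sub>t\<close> of \<open>d\<^sub>1(e\<^sub>i) \<and> w11 xs\<close>.\<close>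

definition d1_wedge_w11 :: "'a::comm_ring_1 complex3 \<Rightarrow> (nat list \<Rightarrow> nat \<Rightarrow> nat \<Rightarrow> 'a) \<Rightarrow>
    nat \<Rightarrow> nat list \<Rightarrow> nat \<Rightarrow> 'a" where
  "d1_wedge_w11 C w11 i xs t = df1 C 1 i * w11 xs 2 t - df1 C 2 i * w11 xs 1 t"

text \<open>
  An element of \<open>F\<^sub>2 \<otimes> F\<^sub>2\<close> is a matrix of coefficients; \<open>sym2\<close> and \<open>alt2\<close> are the coefficients of its
  image in the second symmetric and exterior power. An element \<open>v\<close> of \<open>F\<^sub>2 \<otimes> F\<^sub>3\<close> has the coefficient
  \<open>v h t\<close> at \<open>f\<^sub>h \<otimes> g\<^sub>t\<close>; \<open>push3\<close> applies \<open>d\<^sub>3\<close> to its second factor and puts it in front.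
\<close>

definition sym2 :: "'a::comm_ring_1 mtx \<Rightarrow> nat \<Rightarrow> nat \<Rightarrow> 'a" where
  "sym2 T p q = (if p = q then T p p else T p q + T q p)"

definition alt2 :: "'a::comm_ring_1 mtx \<Rightarrow> nat \<Rightarrow> nat \<Rightarrow> 'a" where
  "alt2 T p q = T p q - T q p"

definition push3 :: "'a::comm_ring_1 complex3 \<Rightarrow> 'a mtx \<Rightarrow> 'a mtx" where
  "push3 C v = (\<lambda>p q. \<Sum>t=1..rk3 C. df3 C p t * v q t)"

definition lifts_sym2 :: "'a::comm_ring_1 complex3 \<Rightarrow> 'a mtx \<Rightarrow> 'a mtx \<Rightarrow> bool" where
  "lifts_sym2 C v T \<longleftrightarrow> (\<forall>p\<in>{1..rk2 C}. \<forall>q\<in>{1..rk2 C}. sym2 (push3 C v) p q = sym2 T p q)"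

definition lifts_alt2 :: "'a::comm_ring_1 complex3 \<Rightarrow> 'a mtx \<Rightarrow> 'a mtx \<Rightarrow> bool" where
  "lifts_alt2 C v T \<longleftrightarrow> (\<forall>p\<in>{1..rk2 C}. \<forall>q\<in>{1..rk2 C}. alt2 (push3 C v) p q = alt2 T p q)"

text \<open>
  The element of \<open>F\<^sub>2 \<otimes> F\<^sub>2\<close> belonging to \<open>e\<^sub>a \<and> e\<^sub>b \<and> e\<^sub>c \<and> e\<^sub>d \<and> e\<^sub>e \<otimes> e\<^sub>a\<close>, where \<open>ys = [b,c,d,e]\<close>.
\<close>

definition q321 :: "(nat list \<Rightarrow> nat \<Rightarrow> 'a::comm_ring_1) \<Rightarrow> nat \<Rightarrow> nat list \<Rightarrow> 'a mtx" where
  "q321 w31 a ys = (\<lambda>p q.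
      w31 [a, nth1 ys 1, nth1 ys 2] p * w31 [a, nth1 ys 3, nth1 ys 4] q
    - w31 [a, nth1 ys 1, nth1 ys 3] p * w31 [a, nth1 ys 2, nth1 ys 4] q
    + w31 [a, nth1 ys 1, nth1 ys 4] p * w31 [a, nth1 ys 2, nth1 ys 3] q)"

text \<open>
  \<open>v\<close> is an admissible value of \<open>w321\<close> at the wedge of \<open>xs\<close> tensored with the \<open>j\<close>-th entry of \<open>xs\<close>;
  the sign moves that entry to the first position. Lifts need not be unique.
\<close>

definition w321_value :: "'a::comm_ring_1 complex3 \<Rightarrow> (nat list \<Rightarrow> nat \<Rightarrow> 'a) \<Rightarrow>
    nat list \<Rightarrow> nat \<Rightarrow> 'a mtx \<Rightarrow> bool" where
  "w321_value C w31 xs j v \<longleftrightarrow>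
     lifts_sym2 C v (\<lambda>p q. (-1) ^ (j + 1) * q321 w31 (nth1 xs j) (omit {j} xs) p q)"

text \<open>
  \<open>w321 xs i h t\<close> is the coefficient at \<open>f\<^sub>h \<otimes> g\<^sub>t\<close> of the value at the wedge of \<open>xs\<close> tensored with
  \<open>e\<^sub>i\<close>. Values with \<open>i\<close> not in \<open>xs\<close> are left free, they are not needed.
\<close>

definition is_w321 :: "'a::comm_ring_1 complex3 \<Rightarrow> (nat list \<Rightarrow> nat \<Rightarrow> 'a) \<Rightarrow>
    (nat list \<Rightarrow> nat \<Rightarrow> nat \<Rightarrow> nat \<Rightarrow> 'a) \<Rightarrow> bool" where
  "is_w321 C w31 w321 \<longleftrightarrow>
     (\<forall>i\<in>{1..rk1 C}. \<forall>h\<in>{1..rk2 C}. alternating 5 (rk1 C) (\<lambda>xs. w321 xs i h)) \<and>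
     (\<forall>xs j. wedge_args (rk1 C) 5 xs \<and> j \<in> {1..5} \<longrightarrow> w321_value C w31 xs j (w321 xs (nth1 xs j)))"

definition q322 :: "(nat list \<Rightarrow> nat \<Rightarrow> 'a::comm_ring_1) \<Rightarrow> nat list \<Rightarrow> 'a mtx" where
  "q322 w31 xs = (\<lambda>p q. \<Sum>j=1..5. \<Sum>i=1..<j.
     (-1) ^ (i + j + 1) * w31 [nth1 xs i, nth1 xs j, nth1 xs 6] p * w31 (omit {i, j, 6} xs) q)"

text \<open>
  The lift is taken along \<open>F\<^sub>3 \<otimes> F\<^sub>2 \<rightarrow> \<Lambda>\<^sup>2F\<^sub>2\<close>: exchanging the two factors of the products in \<open>q322\<close> is an
  odd permutation of \<open>xs\<close>, so that \<open>q322\<close> is skew-symmetric in \<open>xs\<close> modulo symmetric tensors, but not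
  modulo alternating ones. No condition arises, and all values vanish, if the rank of \<open>F\<^sub>1\<close> is 5.
\<close>

definition w322_value :: "'a::comm_ring_1 complex3 \<Rightarrow> (nat list \<Rightarrow> nat \<Rightarrow> 'a) \<Rightarrow>
    nat list \<Rightarrow> 'a mtx \<Rightarrow> bool" where
  "w322_value C w31 xs v \<longleftrightarrow> lifts_alt2 C v (q322 w31 xs)"

definition is_w322 :: "'a::comm_ring_1 complex3 \<Rightarrow> (nat list \<Rightarrow> nat \<Rightarrow> 'a) \<Rightarrow>
    (nat list \<Rightarrow> nat \<Rightarrow> nat \<Rightarrow> 'a) \<Rightarrow> bool" where
  "is_w322 C w31 w322 \<longleftrightarrow>
     (\<forall>h\<in>{1..rk2 C}. alternating 6 (rk1 C) (\<lambda>xs. w322 xs h)) \<and>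
     (\<forall>xs. wedge_args (rk1 C) 6 xs \<longrightarrow> w322_value C w31 xs (w322 xs))"

text \<open>
  An element of \<open>\<Lambda>\<^sup>2F\<^sub>3\<close> is a skew-symmetric matrix \<open>c\<close>, with \<open>c t s\<close> the coefficient at \<open>g\<^sub>t \<and> g\<^sub>s\<close> for
  \<open>t < s\<close>, and an element of \<open>S\<^sub>2F\<^sub>3\<close> is a symmetric matrix \<open>c\<close>, with \<open>c t s\<close> the coefficient at \<open>g\<^sub>t g\<^sub>s\<close>
  for \<open>t \<le> s\<close>. The conditions compare the images of \<open>c\<close> in \<open>F\<^sub>2 \<otimes> F\<^sub>3\<close>, under
  \<open>a \<and> b \<mapsto> d\<^sub>3(a) \<otimes> b - d\<^sub>3(b) \<otimes> a\<close> and \<open>ab \<mapsto> d\<^sub>3(a) \<otimes> b + d\<^sub>3(b) \<otimes> a\<close>, with \<open>T\<close>.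
\<close>

definition lifts_wedge3 :: "'a::comm_ring_1 complex3 \<Rightarrow> 'a mtx \<Rightarrow> 'a mtx \<Rightarrow> bool" where
  "lifts_wedge3 C c T \<longleftrightarrow>
     (\<forall>t\<in>{1..rk3 C}. c t t = 0 \<and> (\<forall>s\<in>{1..rk3 C}. c t s = - c s t)) \<and>
     (\<forall>p\<in>{1..rk2 C}. \<forall>s\<in>{1..rk3 C}. (\<Sum>t=1..rk3 C. df3 C p t * c t s) = T p s)"

definition lifts_sym3 :: "'a::comm_ring_1 complex3 \<Rightarrow> 'a mtx \<Rightarrow> 'a mtx \<Rightarrow> bool" where
  "lifts_sym3 C c T \<longleftrightarrow>
     (\<forall>t\<in>{1..rk3 C}. \<forall>s\<in>{1..rk3 C}. c t s = c s t) \<and>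
     (\<forall>p\<in>{1..rk2 C}. \<forall>s\<in>{1..rk3 C}.
        (\<Sum>t=1..rk3 C. df3 C p t * (if t = s then 2 * c t s else c t s)) = T p s)"

text \<open>
  The elements of \<open>F\<^sub>2 \<otimes> F\<^sub>3\<close> lifted by \<open>w221\<close> at \<open>e\<^sub>a \<and> e\<^sub>b \<and> e\<^sub>c \<and> e\<^sub>d \<otimes> e\<^sub>a \<otimes> f\<^sub>h\<close> and, for
  \<open>xs = [a,b,c,d]\<close> and \<open>e\<close> not in \<open>xs\<close>, at \<open>e\<^sub>a \<and> e\<^sub>b \<and> e\<^sub>c \<and> e\<^sub>d \<otimes> e\<^sub>e \<otimes> f\<^sub>h\<close>. The signs and coefficients are
  those for which both lie in the kernel of \<open>F\<^sub>2 \<otimes> F\<^sub>3 \<rightarrow> S\<^sub>2F\<^sub>2\<close>: for instance the first three terms of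
  \<open>q221_rep\<close> contribute minus \<open>q321 w31 a\<close>, applied to \<open>b,c,d,d\<^sub>2(f\<^sub>h)\<close>, which the last term cancels.
\<close>

definition q221_rep :: "'a::comm_ring_1 complex3 \<Rightarrow> (nat list \<Rightarrow> nat \<Rightarrow> 'a) \<Rightarrow>
    (nat list \<Rightarrow> nat \<Rightarrow> nat \<Rightarrow> 'a) \<Rightarrow> (nat list \<Rightarrow> nat \<Rightarrow> nat \<Rightarrow> 'a) \<Rightarrow>
    (nat list \<Rightarrow> nat \<Rightarrow> nat \<Rightarrow> nat \<Rightarrow> 'a) \<Rightarrow> nat \<Rightarrow> nat \<Rightarrow> nat \<Rightarrow> nat \<Rightarrow> nat \<Rightarrow> 'a mtx" where
  "q221_rep C w31 w21 w11 w321 a b c d h = (\<lambda>p t.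
      w31 [a, b, c] p * w21 [a, d] h t
    - w31 [a, b, d] p * w21 [a, c] h t
    + w31 [a, c, d] p * w21 [a, b] h t
    + of_bool (p = h) * d1_wedge_w11 C w11 a [a, b, c, d] t
    + (\<Sum>l=1..rk1 C. df2 C l h * w321 [a, b, c, d, l] a p t))"

definition q221_new :: "'a::comm_ring_1 \<Rightarrow> 'a complex3 \<Rightarrow> (nat list \<Rightarrow> nat \<Rightarrow> 'a) \<Rightarrow>
    (nat list \<Rightarrow> nat \<Rightarrow> nat \<Rightarrow> 'a) \<Rightarrow> (nat list \<Rightarrow> nat \<Rightarrow> nat \<Rightarrow> 'a) \<Rightarrow>
    (nat list \<Rightarrow> nat \<Rightarrow> nat \<Rightarrow> nat \<Rightarrow> 'a) \<Rightarrow> nat list \<Rightarrow> nat \<Rightarrow> nat \<Rightarrow> 'a mtx" where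
  "q221_new half C w31 w21 w11 w321 xs e h = (\<lambda>p t.
      (\<Sum>j=1..4. \<Sum>i=1..<j.
         (-1) ^ (i + j + 1) * w31 [nth1 xs i, nth1 xs j, e] p * w21 (omit {i, j} xs) h t)
    + half * of_bool (p = h) *
        ((\<Sum>i=1..4. (-1) ^ i * d1_wedge_w11 C w11 (nth1 xs i) (omit {i} (xs @ [e])) t)
         + d1_wedge_w11 C w11 e xs t)
    + (\<Sum>l=1..rk1 C. df2 C l h * (w321 (xs @ [l]) e p t + w321 (xs @ [e]) l p t)))"

text \<open>\<open>w221 xs i h\<close> is the value at the wedge of \<open>xs\<close> tensored with \<open>e\<^sub>i \<otimes> f\<^sub>h\<close>.\<close>

definition is_w221 :: "'a::comm_ring_1 \<Rightarrow> 'a complex3 \<Rightarrow> (nat list \<Rightarrow> nat \<Rightarrow> 'a) \<Rightarrow>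
    (nat list \<Rightarrow> nat \<Rightarrow> nat \<Rightarrow> 'a) \<Rightarrow> (nat list \<Rightarrow> nat \<Rightarrow> nat \<Rightarrow> 'a) \<Rightarrow>
    (nat list \<Rightarrow> nat \<Rightarrow> nat \<Rightarrow> nat \<Rightarrow> 'a) \<Rightarrow>
    (nat list \<Rightarrow> nat \<Rightarrow> nat \<Rightarrow> nat \<Rightarrow> nat \<Rightarrow> 'a) \<Rightarrow> bool" where
  "is_w221 half C w31 w21 w11 w321 w221 \<longleftrightarrow>
     (\<forall>h\<in>{1..rk2 C}.
        (\<forall>i\<in>{1..rk1 C}. \<forall>t\<in>{1..rk3 C}. alternating 4 (rk1 C) (\<lambda>xs. w221 xs i h t)) \<and>
        (\<forall>a b c d. wedge_args (rk1 C) 4 [a, b, c, d] \<longrightarrow>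
           lifts_wedge3 C (w221 [a, b, c, d] a h) (q221_rep C w31 w21 w11 w321 a b c d h)) \<and>
        (\<forall>xs e. length xs = 4 \<and> wedge_args (rk1 C) 5 (xs @ [e]) \<longrightarrow>
           lifts_wedge3 C (w221 xs e h) (q221_new half C w31 w21 w11 w321 xs e h)))"

text \<open>
  Again the signs are those for which the element lies in the kernel of \<open>F\<^sub>2 \<otimes> F\<^sub>3 \<rightarrow> \<Lambda>\<^sup>2F\<^sub>2\<close>.
\<close>

definition q222 :: "'a::comm_ring_1 \<Rightarrow> 'a complex3 \<Rightarrow> (nat list \<Rightarrow> nat \<Rightarrow> 'a) \<Rightarrow>
    (nat list \<Rightarrow> nat \<Rightarrow> nat \<Rightarrow> 'a) \<Rightarrow> (nat list \<Rightarrow> nat \<Rightarrow> nat \<Rightarrow> 'a) \<Rightarrow>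
    (nat list \<Rightarrow> nat \<Rightarrow> nat \<Rightarrow> 'a) \<Rightarrow> nat list \<Rightarrow> nat \<Rightarrow> 'a mtx" where
  "q222 half C w31 w21 w11 w322 xs h = (\<lambda>p t.
      (\<Sum>k=1..5. \<Sum>j=1..<k. \<Sum>i=1..<j. (-1) ^ (i + j + k + 1) *
         w31 [nth1 xs i, nth1 xs j, nth1 xs k] p * w21 (omit {i, j, k} xs) h t)
    + half * of_bool (p = h) *
        (\<Sum>i=1..5. (-1) ^ i * d1_wedge_w11 C w11 (nth1 xs i) (omit {i} xs) t)
    - (\<Sum>l=1..rk1 C. df2 C l h * w322 (xs @ [l]) p t))"

definition is_w222 :: "'a::comm_ring_1 \<Rightarrow> 'a complex3 \<Rightarrow> (nat list \<Rightarrow> nat \<Rightarrow> 'a) \<Rightarrow>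
    (nat list \<Rightarrow> nat \<Rightarrow> nat \<Rightarrow> 'a) \<Rightarrow> (nat list \<Rightarrow> nat \<Rightarrow> nat \<Rightarrow> 'a) \<Rightarrow>
    (nat list \<Rightarrow> nat \<Rightarrow> nat \<Rightarrow> 'a) \<Rightarrow> (nat list \<Rightarrow> nat \<Rightarrow> nat \<Rightarrow> nat \<Rightarrow> 'a) \<Rightarrow> bool" where
  "is_w222 half C w31 w21 w11 w322 w222 \<longleftrightarrow>
     (\<forall>h\<in>{1..rk2 C}.
        (\<forall>t\<in>{1..rk3 C}. alternating 5 (rk1 C) (\<lambda>xs. w222 xs h t)) \<and>
        (\<forall>xs. wedge_args (rk1 C) 5 xs \<longrightarrow>
           lifts_sym3 C (w222 xs h) (q222 half C w31 w21 w11 w322 xs h)))"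


section \<open>The linked complex\<close>

definition br_ideal :: "'a::comm_ring_1 complex3 \<Rightarrow> 'a set" where
  "br_ideal A = gen_ideal {minor2 (df1 A) i j | i j. i \<in> {1..4} \<and> j \<in> {1..4}}"

text \<open>
  The mapping cone after removal of the redundant elements \<open>\<epsilon>\<^sub>1,\<dots>,\<epsilon>\<^sub>4\<close>. The basis of \<open>D\<^sub>1\<close> is ordered as
  \<open>s\<^sub>1,\<dots>,s\<^sub>4,\<gamma>\<^sub>1,\<dots>,\<gamma>\<^bsub>r\<^sub>3\<^esub>\<close>, so that \<open>s\<^sub>j\<close> has index \<open>j\<close> and \<open>\<gamma>\<^sub>t\<close> has index \<open>4 + t\<close>; the basis of \<open>D\<^sub>2\<close> is
  \<open>\<phi>\<^sub>1,\<dots>,\<phi>\<^bsub>r\<^sub>2\<^esub>\<close>, and \<open>\<epsilon>\<^bsub>k+4\<^esub>\<close> has index \<open>k\<close> in the basis of \<open>D\<^sub>3\<close>.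
\<close>

definition linked_complex :: "'a::comm_ring_1 complex3 \<Rightarrow> (nat list \<Rightarrow> nat \<Rightarrow> 'a) \<Rightarrow>
    (nat list \<Rightarrow> nat \<Rightarrow> nat \<Rightarrow> 'a) \<Rightarrow> 'a complex3" where
  "linked_complex A w31 w11 =
     \<lparr> rk1 = rk3 A + 4, rk2 = rk2 A, rk3 = rk1 A - 4,
       df1 = (\<lambda>u i. if i \<le> 4 then df1 A u i else w11 [1,2,3,4] u (i - 4)),
       df2 = (\<lambda>i h. if i \<le> 4 then - ((-1) ^ (i + 1) * w31 (omit {i} [1,2,3,4]) h) else df3 A h (i - 4)),
       df3 = (\<lambda>h k. df2 A (k + 4) h) \<rparr>"

text \<open>
  The map \<open>w31\<close> of the linked complex, with \<open>t\<^sub>r = \<Sum>\<^sub>h y\<^bsub>rh\<^esub> \<phi>\<^sub>h\<close>. The conditions determine it,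
  because there are at most two elements \<open>\<gamma>\<^sub>t\<close>. With these signs it satisfies the defining equation of
  \<open>w31\<close> for the linked complex after the change of basis \<open>s\<^sub>j \<mapsto> -s\<^sub>j\<close>, which does not affect \<open>df3\<close>, the
  only differential entering \<open>w321\<close> and \<open>w322\<close>.
\<close>

definition is_linked_w31 :: "'a::comm_ring_1 complex3 \<Rightarrow> (nat list \<Rightarrow> nat \<Rightarrow> nat \<Rightarrow> 'a) \<Rightarrow>
    (nat list \<Rightarrow> nat \<Rightarrow> nat \<Rightarrow> nat \<Rightarrow> nat \<Rightarrow> 'a) \<Rightarrow> (nat list \<Rightarrow> nat \<Rightarrow> 'a) \<Rightarrow> bool" where
  "is_linked_w31 A w21 w221 wD \<longleftrightarrow>
     alternating 3 (rk3 A + 4) wD \<and>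
     (\<forall>i j k r h. i < j \<and> j < k \<and> {i, j, k, r} = {1,2,3,4} \<and> h \<in> {1..rk2 A} \<longrightarrow>
        wD [i, j, k] h = (-1) ^ r * df2 A r h) \<and>
     (\<forall>i\<in>{1..4}. \<forall>j\<in>{1..4}. \<forall>t\<in>{1..rk3 A}. \<forall>h\<in>{1..rk2 A}.
        wD [i, j, 4 + t] h = w21 [i, j] h t) \<and>
     (\<forall>i\<in>{1..4}. \<forall>t\<in>{1..rk3 A}. \<forall>s\<in>{1..rk3 A}. t \<noteq> s \<longrightarrow> (\<forall>h\<in>{1..rk2 A}.
        wD [i, 4 + t, 4 + s] h = w221 [1,2,3,4] i h t s))"

end

theory Submission
  imports Defs
begin

text \<open>
  Since the third differential of \<open>D\<close> is the transpose of the rows \<open>5,\<dots>,r\<^sub>1\<close> of \<open>d\<^sub>2\<close>, pushing the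
  claimed values into \<open>S\<^sub>2D\<^sub>2\<close> or \<open>\<Lambda>\<^sup>2D\<^sub>2\<close> means evaluating structure maps of \<open>A\<close> at \<open>d\<^sub>2(f\<^sub>p)\<close>. The rows
  \<open>1,\<dots>,4\<close>, which enter through \<open>w31\<close> of \<open>D\<close>, complete the sums, so that the three claims become
  identities for the structure maps of \<open>A\<close> contracted with \<open>d\<^sub>2\<close>:
  (1) \<open>w21(d\<^sub>2(f\<^sub>p) \<and> e\<^sub>j \<otimes> f\<^sub>q)\<close> is skew-symmetric in \<open>p, q\<close>; (2) the symmetrization in \<open>p, q\<close> of
  \<open>w222(\<epsilon> \<and> d\<^sub>2(f\<^sub>p) \<otimes> f\<^sub>q)\<close> is the Pfaffian expression in products \<open>w21(e\<^sub>i \<and> e\<^sub>j) w21(e\<^sub>k \<and> e\<^sub>l)\<close>;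
  (3) likewise for \<open>w221(\<epsilon> \<otimes> d\<^sub>2(f\<^sub>p) \<otimes> f\<^sub>q)\<close> with skew-symmetrization. As \<open>d\<^sub>3\<close> is injective, each can
  be checked after applying \<open>d\<^sub>3\<close>, where the defining equations, \<open>d\<^sub>1 d\<^sub>2 = 0\<close> and the Pluecker relation
  for the minors of \<open>d\<^sub>1\<close> suffice; the contributions of \<open>w321\<close> and \<open>w322\<close> cancel by symmetry.
\<close>

section \<open>Contraction with d_2, application of d_3, and what exactness says about them\<close>

text \<open>\<open>pair_d2 C f h\<close> is the value at \<open>d\<^sub>2(f\<^sub>h)\<close> of the linear form with \<open>e\<^sub>l \<mapsto> f l\<close>.\<close>

definition pair_d2 :: "'a::comm_ring_1 complex3 \<Rightarrow> (nat \<Rightarrow> 'a) \<Rightarrow> nat \<Rightarrow> 'a" where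
  "pair_d2 C f h = (\<Sum>l=1..rk1 C. df2 C l h * f l)"

definition app_d3 :: "'a::comm_ring_1 complex3 \<Rightarrow> (nat \<Rightarrow> 'a) \<Rightarrow> nat \<Rightarrow> 'a" where
  "app_d3 C c p = (\<Sum>t=1..rk3 C. df3 C p t * c t)"

lemma pair_d2_linear:
  "pair_d2 C (\<lambda>l. f l + g l) h = pair_d2 C f h + pair_d2 C g h"
  "pair_d2 C (\<lambda>l. f l - g l) h = pair_d2 C f h - pair_d2 C g h"
  "pair_d2 C (\<lambda>l. - f l) h = - pair_d2 C f h"
  "pair_d2 C (\<lambda>l. c * f l) h = c * pair_d2 C f h"
  "pair_d2 C (\<lambda>l. f l * c) h = pair_d2 C f h * c"
  by (simp_all add: pair_d2_def sum.distrib sum_subtractf sum_negf sum_distrib_left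
      sum_distrib_right algebra_simps)

lemma app_d3_linear:
  "app_d3 C (\<lambda>l. f l + g l) h = app_d3 C f h + app_d3 C g h"
  "app_d3 C (\<lambda>l. f l - g l) h = app_d3 C f h - app_d3 C g h"
  "app_d3 C (\<lambda>l. - f l) h = - app_d3 C f h"
  "app_d3 C (\<lambda>l. c * f l) h = c * app_d3 C f h"
  "app_d3 C (\<lambda>l. f l * c) h = app_d3 C f h * c"
  by (simp_all add: app_d3_def sum.distrib sum_subtractf sum_negf sum_distrib_left
      sum_distrib_right algebra_simps)

lemma app_d3_pair_d2:
  "app_d3 C (\<lambda>t. pair_d2 C (\<lambda>l. f l t) h) p = pair_d2 C (\<lambda>l. app_d3 C (f l) p) h"
  unfolding app_d3_def pair_d2_def sum_distrib_left
  by (subst sum.swap) (simp add: algebra_simps)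

text \<open>Used to see that a symmetric or skew bilinear form has a symmetric or skew double
  contraction with d_2(f_p) and d_2(f_q); this later removes the \<open>w321\<close> and
  \<open>w322\<close> terms.\<close>

lemma pair_d2_swap:
  "pair_d2 C (\<lambda>l. pair_d2 C (\<lambda>k. f l k) q) p = pair_d2 C (\<lambda>l. pair_d2 C (\<lambda>k. f k l) p) q"
  unfolding pair_d2_def sum_distrib_left
  by (subst sum.swap) (simp add: algebra_simps)

lemma pair_d2_cong:
  assumes "\<And>l. l \<in> {1..rk1 C} \<Longrightarrow> f l = g l"
  shows "pair_d2 C f h = pair_d2 C g h"
  using assms by (simp add: pair_d2_def)

lemma app_d3_cong:
  assumes "\<And>t. t \<in> {1..rk3 C} \<Longrightarrow> f t = g t"
  shows "app_d3 C f p = app_d3 C g p"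
  using assms by (simp add: app_d3_def)

lemma acyclic3_d1_d2:
  assumes "acyclic3 C" "u \<in> {1..2}" "h \<in> {1..rk2 C}"
  shows "pair_d2 C (df1 C u) h = 0"
proof -
  define v where "v = mat_app (rk1 C) (rk2 C) (df2 C) (\<lambda>i. of_bool (i = h))"
  have "(\<lambda>i. of_bool (i = h)) \<in> (free_mod (rk2 C) :: (nat \<Rightarrow> 'a) set)"
    using assms(3) by (auto simp: free_mod_def)
  then have "v \<in> mat_ker 2 (rk1 C) (df1 C)"
    using assms(1) unfolding acyclic3_def mat_im_def v_def by blast
  then have "mat_app 2 (rk1 C) (df1 C) v u = 0"
    by (simp add: mat_ker_def)
  moreover have "v l = df2 C l h" if "l \<in> {1..rk1 C}" for l
  proof -
    have "v l = (\<Sum>j=1..rk2 C. if j = h then df2 C l j else 0)"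
      using that unfolding v_def mat_app_def by (auto intro!: sum.cong)
    then show ?thesis using assms(3) by simp
  qed
  ultimately show ?thesis
    using assms(2) by (simp add: mat_app_def pair_d2_def mult.commute)
qed

lemma acyclic3_d3_inj:
  assumes "acyclic3 C" and eq: "\<And>p. p \<in> {1..rk2 C} \<Longrightarrow> app_d3 C a p = app_d3 C b p"
    and "t \<in> {1..rk3 C}"
  shows "a t = b t"
proof -
  \<comment> \<open>\<open>mat_ker\<close> contains only functions supported on
    \<open>{1..rk3 C}\<close>, while \<open>a\<close> and \<open>b\<close> are arbitrary, so their
    difference is cut off outside.\<close>
  define v where "v = (\<lambda>t. if t \<in> {1..rk3 C} then a t - b t else 0)"
  have "mat_app (rk2 C) (rk3 C) (df3 C) v p = 0" for p
  proof -
    have "app_d3 C v p = app_d3 C (\<lambda>t. a t - b t) p"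
      by (rule app_d3_cong) (simp add: v_def)
    then show ?thesis
      using eq[of p] by (auto simp: mat_app_def app_d3_linear app_d3_def)
  qed
  then have "v \<in> mat_ker (rk2 C) (rk3 C) (df3 C)"
    by (auto simp: mat_ker_def free_mod_def v_def)
  then have "v = (\<lambda>_. 0)"
    using assms(1) by (simp add: acyclic3_def)
  then have "v t = 0" by simp
  then show ?thesis using assms(3) by (simp add: v_def)
qed

lemma half_cancel:
  assumes "2 * half = (1 :: 'a::comm_ring_1)"
  shows "half * (2 * x) = x"
  using assms by (metis mult.assoc mult.commute mult_1)

section \<open>Sign rules for alternating functions on short lists\<close>

lemma alternating_swap:
  assumes "alternating n r w" "length xs = n" "set xs \<subseteq> {1..r}" "i < n" "j < n" "i \<noteq> j"
  shows "w (xs[i := xs ! j, j := xs ! i]) k = - w xs k"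
  using assms unfolding alternating_def by blast

lemma alternating_repeated:
  assumes "alternating n r w" "length xs = n" "set xs \<subseteq> {1..r}" "\<not> distinct xs"
  shows "w xs k = 0"
  using assms unfolding alternating_def by blast

lemma alternating_2_swap:
  assumes "alternating 2 r w" "{a, b} \<subseteq> {1..r}"
  shows "w [b, a] k = - w [a, b] k"
  using alternating_swap[OF assms(1), of "[a, b]" 0 1 k] assms(2) by simp

lemma alternating_3_swap:
  assumes "alternating 3 r w" "{a, b, c} \<subseteq> {1..r}"
  shows "w [b, a, c] k = - w [a, b, c] k" "w [a, c, b] k = - w [a, b, c] k" "w [c, b, a] k = - w [a, b, c] k"
  using alternating_swap[OF assms(1), of "[a, b, c]" 0 1 k]
    alternating_swap[OF assms(1), of "[a, b, c]" 1 2 k]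
    alternating_swap[OF assms(1), of "[a, b, c]" 0 2 k] assms(2) by (simp_all add: numeral_2_eq_2)

lemma alternating_3_rotate:
  assumes "alternating 3 r w" "{a, b, c} \<subseteq> {1..r}"
  shows "w [b, c, a] k = w [a, b, c] k" "w [c, a, b] k = w [a, b, c] k"
  using alternating_3_swap(2)[OF assms(1), of b a c k] alternating_3_swap(1)[OF assms(1), of a b c k]
    alternating_3_swap(1)[OF assms(1), of a c b k] alternating_3_swap(2)[OF assms(1), of a b c k]
    assms(2) by simp_all

lemma alternating_4_swap:
  assumes "alternating 4 r w" "{a, b, c, d} \<subseteq> {1..r}"
  shows "w [b, a, c, d] k = - w [a, b, c, d] k"
    and "w [a, c, b, d] k = - w [a, b, c, d] k"
    and "w [a, b, d, c] k = - w [a, b, c, d] k"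
    and "w [c, b, a, d] k = - w [a, b, c, d] k"
    and "w [d, b, c, a] k = - w [a, b, c, d] k"
  using alternating_swap[OF assms(1), of "[a, b, c, d]" 0 1 k]
    alternating_swap[OF assms(1), of "[a, b, c, d]" 1 2 k]
    alternating_swap[OF assms(1), of "[a, b, c, d]" 2 3 k]
    alternating_swap[OF assms(1), of "[a, b, c, d]" 0 2 k]
    alternating_swap[OF assms(1), of "[a, b, c, d]" 0 3 k] assms(2)
  by (simp_all add: numeral_2_eq_2 numeral_3_eq_3)

text \<open>A 4-cycle is odd and a 3-cycle is even.\<close>

lemma alternating_4_last:
  assumes "alternating 4 r w" "{a, b, c, d} \<subseteq> {1..r}"
  shows "w [b, c, d, a] k = - w [a, b, c, d] k"
    and "w [a, c, d, b] k = w [a, b, c, d] k"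
  using alternating_4_swap(3)[OF assms(1), of b c a d k] alternating_4_swap(2)[OF assms(1), of b a c d k]
    alternating_4_swap(1)[OF assms(1), of a b c d k] alternating_4_swap(3)[OF assms(1), of a c b d k]
    alternating_4_swap(2)[OF assms(1), of a b c d k] assms(2)
  by simp_all

section \<open>Explicit expansion of the elements to be lifted, and criteria for lifts\<close>

lemma nth1_Cons:
  "nth1 (x1 # xs) 1 = x1"
  "nth1 (x1 # x2 # xs) 2 = x2"
  "nth1 (x1 # x2 # x3 # xs) 3 = x3"
  "nth1 (x1 # x2 # x3 # x4 # xs) 4 = x4"
  "nth1 (x1 # x2 # x3 # x4 # x5 # xs) 5 = x5"
  "nth1 (x1 # x2 # x3 # x4 # x5 # x6 # xs) 6 = x6"
  by (simp_all add: nth1_def)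

text \<open>Appending an entry leaves the earlier positions unchanged. Repeated use evaluates
  \<open>omit\<close> on explicit lists.\<close>

lemma omit_snoc: "omit J (xs @ [x]) = omit J xs @ (if Suc (length xs) \<in> J then [] else [x])"
proof -
  have "map (nth1 (xs @ [x])) (filter (\<lambda>k. k \<notin> J) [1..<Suc (length xs)])
      = map (nth1 xs) (filter (\<lambda>k. k \<notin> J) [1..<Suc (length xs)])"
    by (auto simp: nth1_def nth_append)
  then show ?thesis
    by (simp add: omit_def nth1_def nth_append)
qed

lemma omit_Cons:
  "omit J [a, b, c, d] = (if 1 \<in> J then [] else [a]) @ (if 2 \<in> J then [] else [b]) @
    (if 3 \<in> J then [] else [c]) @ (if 4 \<in> J then [] else [d])"
  "omit J [a, b, c, d, e] = omit J [a, b, c, d] @ (if 5 \<in> J then [] else [e])"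
  "omit J [a, b, c, d, e, f] = omit J [a, b, c, d, e] @ (if 6 \<in> J then [] else [f])"
  using omit_snoc[of J "[]" a] omit_snoc[of J "[a]" b] omit_snoc[of J "[a, b]" c]
    omit_snoc[of J "[a, b, c]" d] omit_snoc[of J "[a, b, c, d]" e] omit_snoc[of J "[a, b, c, d, e]" f]
  by (simp_all add: numeral_eq_Suc) (simp_all add: omit_def)

lemma sum_upto:
  fixes f :: "nat \<Rightarrow> 'a::comm_ring_1"
  shows "(\<Sum>i=1..4. f i) = f 1 + f 2 + f 3 + f 4"
    and "(\<Sum>i=1..5. f i) = f 1 + f 2 + f 3 + f 4 + f 5"
    and "(\<Sum>i=1..<1. f i) = 0"
    and "(\<Sum>i=1..<2. f i) = f 1"
    and "(\<Sum>i=1..<3. f i) = f 1 + f 2"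
    and "(\<Sum>i=1..<4. f i) = f 1 + f 2 + f 3"
    and "(\<Sum>i=1..<5. f i) = f 1 + f 2 + f 3 + f 4"
  by (simp_all add: numeral_eq_Suc)

lemma q222_expand:
  "q222 half C w31 w21 w11 w322 [a, b, c, d, e] h p t =
     - w31 [a, b, c] p * w21 [d, e] h t + w31 [a, b, d] p * w21 [c, e] h t
     - w31 [a, c, d] p * w21 [b, e] h t + w31 [b, c, d] p * w21 [a, e] h t
     - w31 [a, b, e] p * w21 [c, d] h t + w31 [a, c, e] p * w21 [b, d] h t
     - w31 [a, d, e] p * w21 [b, c] h t - w31 [b, c, e] p * w21 [a, d] h t
     + w31 [b, d, e] p * w21 [a, c] h t - w31 [c, d, e] p * w21 [a, b] h t
     + half * of_bool (p = h) *
       (- d1_wedge_w11 C w11 a [b, c, d, e] t + d1_wedge_w11 C w11 b [a, c, d, e] t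
        - d1_wedge_w11 C w11 c [a, b, d, e] t + d1_wedge_w11 C w11 d [a, b, c, e] t
        - d1_wedge_w11 C w11 e [a, b, c, d] t)
     - pair_d2 C (\<lambda>l. w322 [a, b, c, d, e, l] p t) h"
  by (simp add: q222_def omit_Cons nth1_Cons sum_upto pair_d2_def del: One_nat_def)

lemma q221_new_expand:
  "q221_new half C w31 w21 w11 w321 [a, b, c, d] e h p t =
     w31 [a, b, e] p * w21 [c, d] h t - w31 [a, c, e] p * w21 [b, d] h t
     + w31 [a, d, e] p * w21 [b, c] h t + w31 [b, c, e] p * w21 [a, d] h t
     - w31 [b, d, e] p * w21 [a, c] h t + w31 [c, d, e] p * w21 [a, b] h t
     + half * of_bool (p = h) *
       (- d1_wedge_w11 C w11 a [b, c, d, e] t + d1_wedge_w11 C w11 b [a, c, d, e] t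
        - d1_wedge_w11 C w11 c [a, b, d, e] t + d1_wedge_w11 C w11 d [a, b, c, e] t
        + d1_wedge_w11 C w11 e [a, b, c, d] t)
     + pair_d2 C (\<lambda>l. w321 [a, b, c, d, l] e p t + w321 [a, b, c, d, e] l p t) h"
  by (simp add: q221_new_def omit_Cons nth1_Cons sum_upto pair_d2_def del: One_nat_def)

lemma q322_expand:
  "q322 w31 [a, b, c, d, e, f] p q =
     w31 [a, b, f] p * w31 [c, d, e] q - w31 [a, c, f] p * w31 [b, d, e] q
     + w31 [a, d, f] p * w31 [b, c, e] q + w31 [b, c, f] p * w31 [a, d, e] q
     - w31 [b, d, f] p * w31 [a, c, e] q + w31 [c, d, f] p * w31 [a, b, e] q
     - w31 [a, e, f] p * w31 [b, c, d] q + w31 [b, e, f] p * w31 [a, c, d] q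
     - w31 [c, e, f] p * w31 [a, b, d] q + w31 [d, e, f] p * w31 [a, b, c] q"
  by (simp add: q322_def omit_Cons nth1_Cons sum_upto del: One_nat_def)

lemma sym2_eqI:
  assumes "2 * half = (1 :: 'a::comm_ring_1)" "S p q + S q p = T p q + (T q p :: 'a)"
  shows "sym2 S p q = sym2 T p q"
\<comment> \<open>Off the diagonal the assumption is the claim. On the diagonal it is twice the
  claim, and \<open>half\<close> removes the factor, so later proofs need not separate the two
  cases.\<close>
proof (cases "p = q")
  case True
  then have "half * (2 * S p p) = half * (2 * T p p)"
    using assms(2) by simp
  then show ?thesis
    using True by (simp add: sym2_def half_cancel[OF assms(1)])
qed (use assms in \<open>simp add: sym2_def\<close>)

text \<open>The third differential of the linked complex is the transpose of the rows of d_2 from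
  the fifth on. Adding and subtracting the rows 1 to 4 turns the sum into a contraction with all of
  d_2(f_p); \<open>4 + k\<close> is the index in F_1 of the k-th basis element of D_3.\<close>

lemma push3_linked_complex:
  assumes "4 \<le> rk1 A"
  shows "push3 (linked_complex A w31 w11) (\<lambda>h k. g h (4 + k)) p q =
    pair_d2 A (g q) p
    - (df2 A 1 p * g q 1 + df2 A 2 p * g q 2 + df2 A 3 p * g q 3 + df2 A 4 p * g q 4)"
proof -
  let ?f = "\<lambda>l. df2 A l p * g q l"
  obtain n where n: "rk1 A = 4 + n"
    using assms le_Suc_ex by blast
  have "sum ?f {1..rk1 A} = sum ?f {1..4} + sum ?f {4 + 1..4 + n}"
    unfolding n by (rule sum.ub_add_nat) simp
  also have "sum ?f {4 + 1..4 + n} = (\<Sum>k=1..n. ?f (k + 4))"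
    using sum.shift_bounds_cl_nat_ivl[of ?f 1 4 n] by (simp only: add.commute)
  finally show ?thesis
    by (simp add: push3_def linked_complex_def pair_d2_def n sum_upto add.commute del: One_nat_def)
qed

lemma lifts_wedge3_image:
  assumes "lifts_wedge3 C v T" "p \<in> {1..rk2 C}" "s \<in> {1..rk3 C}"
  shows "app_d3 C (\<lambda>t. v t s) p = T p s"
  using assms unfolding lifts_wedge3_def app_d3_def by blast

text \<open>Used with factors 1 and -1 to carry a lift over to a permuted argument.\<close>

lemma lifts_wedge3_scale:
  assumes "lifts_wedge3 C v' T'"
    and v: "\<And>t s. t \<in> {1..rk3 C} \<Longrightarrow> s \<in> {1..rk3 C} \<Longrightarrow> v t s = c * v' t s"
    and T: "\<And>p s. p \<in> {1..rk2 C} \<Longrightarrow> s \<in> {1..rk3 C} \<Longrightarrow> T p s = c * T' p s"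
  shows "lifts_wedge3 C v T"
  unfolding lifts_wedge3_def
proof (intro conjI ballI)
  fix t s assume ts: "t \<in> {1..rk3 C}" "s \<in> {1..rk3 C}"
  then have "v' t t = 0" "v' t s = - v' s t"
    using assms(1) unfolding lifts_wedge3_def by blast+
  with ts show "v t s = - v s t"
    by (simp add: v)
next
  fix t assume t: "t \<in> {1..rk3 C}"
  then have "v' t t = 0"
    using assms(1) unfolding lifts_wedge3_def by blast
  with t show "v t t = 0"
    by (simp add: v)
next
  fix p s assume ps: "p \<in> {1..rk2 C}" "s \<in> {1..rk3 C}"
  have "app_d3 C (\<lambda>t. v t s) p = app_d3 C (\<lambda>t. c * v' t s) p"
    using ps(2) by (intro app_d3_cong v)
  then show "(\<Sum>t=1..rk3 C. df3 C p t * v t s) = T p s"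
    using lifts_wedge3_image[OF assms(1) ps] T[OF ps]
    unfolding app_d3_linear unfolding app_d3_def by simp
qed

section \<open>First-level structure maps of a fixed resolution and their images under d_3\<close>

locale structure_maps =
  fixes C :: "'a::comm_ring_1 complex3"
    and w31 :: "nat list \<Rightarrow> nat \<Rightarrow> 'a"
    and w21 w11 :: "nat list \<Rightarrow> nat \<Rightarrow> nat \<Rightarrow> 'a"
  assumes acyclic: "acyclic3 C"
    and w31: "is_w31 C w31"
    and w21: "is_w21 C w31 w21"
    and w11: "is_w11 C w31 w11"
begin

lemma alternating_w31: "alternating 3 (rk1 C) w31"
  using w31 by (simp add: is_w31_def)

lemma alternating_w21: "h \<in> {1..rk2 C} \<Longrightarrow> alternating 2 (rk1 C) (\<lambda>xs. w21 xs h)"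
  using w21 by (simp add: is_w21_def)

lemma alternating_w11: "u \<in> {1..2} \<Longrightarrow> alternating 4 (rk1 C) (\<lambda>xs. w11 xs u)"
  using w11 by (simp add: is_w11_def)

lemma w31_repeated:
  assumes "i \<in> {1..rk1 C}" "j \<in> {1..rk1 C}"
  shows "w31 [i, i, j] p = 0" "w31 [i, j, i] p = 0" "w31 [j, i, i] p = 0"
  using alternating_repeated[OF alternating_w31] assms by auto

lemma app_d3_w21:
  assumes "i \<in> {1..rk1 C}" "j \<in> {1..rk1 C}" "h \<in> {1..rk2 C}" "p \<in> {1..rk2 C}"
  shows "app_d3 C (w21 [i, j] h) p =
    minor2 (df1 C) i j * of_bool (p = h) - pair_d2 C (\<lambda>l. w31 [l, i, j] p) h"
  using w21 assms unfolding is_w21_def app_d3_def pair_d2_def by blast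

text \<open>The defining equation concerns distinct indices only, but a contraction with d_2 runs
  over all of them. For repeated indices the left side vanishes and the terms on the right vanish or
  cancel, because \<open>w31\<close> alternates.\<close>

lemma app_d3_w11:
  assumes "{a, b, c, d} \<subseteq> {1..rk1 C}" "u \<in> {1..2}" "p \<in> {1..rk2 C}"
  shows "app_d3 C (w11 [a, b, c, d] u) p =
    df1 C u a * w31 [b, c, d] p - df1 C u b * w31 [a, c, d] p
    + df1 C u c * w31 [a, b, d] p - df1 C u d * w31 [a, b, c] p"
proof (cases "distinct [a, b, c, d]")
  case True
  then have "wedge_args (rk1 C) 4 [a, b, c, d]"
    using assms(1) by (auto simp: wedge_args_def)
  then have "(\<Sum>t=1..rk3 C. df3 C p t * w11 [a, b, c, d] u t) =
      (\<Sum>j=1..4. (-1) ^ (j + 1) * df1 C u (nth1 [a, b, c, d] j) * w31 (omit {j} [a, b, c, d]) p)"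
    using w11 assms(2,3) unfolding is_w11_def by blast
  then show ?thesis
    by (simp add: app_d3_def omit_Cons nth1_Cons sum_upto del: One_nat_def)
next
  case False
  have "app_d3 C (w11 [a, b, c, d] u) p = 0"
    using alternating_repeated[OF alternating_w11, of u "[a, b, c, d]"] False assms
    by (simp add: app_d3_def)
  moreover have "a = b \<or> a = c \<or> a = d \<or> b = c \<or> b = d \<or> c = d"
    using False by auto
  ultimately show ?thesis
    using assms(1) alternating_3_swap(1)[OF alternating_w31, of a b d p]
      alternating_3_swap(2)[OF alternating_w31, of a b c p]
      alternating_3_rotate(1)[OF alternating_w31, of a b c p]
    by (elim disjE) (simp_all add: w31_repeated)
qed

section \<open>Contractions of \<open>w21\<close> and \<open>w11\<close> with d_2\<close>

lemma pair_d2_minor2: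
  assumes "h \<in> {1..rk2 C}"
  shows "pair_d2 C (\<lambda>l. minor2 (df1 C) l j) h = 0"
  using acyclic3_d1_d2[OF acyclic _ assms] by (simp add: minor2_def pair_d2_linear)

text \<open>Under d_3 the term with the minor dies by d_1 d_2 = 0. There remains minus
  \<open>w31\<close> at d_2(f_q), d_2(f_p), e_j, which is skew in p and q.\<close>

lemma w21_d2_skew:
  assumes "j \<in> {1..rk1 C}" "p \<in> {1..rk2 C}" "q \<in> {1..rk2 C}" "t \<in> {1..rk3 C}"
  shows "pair_d2 C (\<lambda>l. w21 [l, j] q t) p = - pair_d2 C (\<lambda>l. w21 [l, j] p t) q"
proof (rule acyclic3_d3_inj[OF acyclic _ assms(4)])
  fix r assume r: "r \<in> {1..rk2 C}"
  have push: "app_d3 C (\<lambda>t. pair_d2 C (\<lambda>l. w21 [l, j] q t) p) r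
      = - pair_d2 C (\<lambda>l. pair_d2 C (\<lambda>k. w31 [k, l, j] r) q) p"
    if "p \<in> {1..rk2 C}" "q \<in> {1..rk2 C}" for p q
  proof -
    have "app_d3 C (\<lambda>t. pair_d2 C (\<lambda>l. w21 [l, j] q t) p) r
        = pair_d2 C (\<lambda>l. minor2 (df1 C) l j * of_bool (r = q)
            - pair_d2 C (\<lambda>k. w31 [k, l, j] r) q) p"
      unfolding app_d3_pair_d2 using that r assms(1) by (intro pair_d2_cong app_d3_w21)
    then show ?thesis
      by (simp add: pair_d2_linear pair_d2_minor2[OF that(1)])
  qed
  have "pair_d2 C (\<lambda>l. pair_d2 C (\<lambda>k. w31 [k, l, j] r) q) p
      = pair_d2 C (\<lambda>l. pair_d2 C (\<lambda>k. - w31 [k, l, j] r) p) q"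
    unfolding pair_d2_swap[of C _ q]
    using assms(1) by (intro pair_d2_cong alternating_3_swap(1)[OF alternating_w31]) auto
  then show "app_d3 C (\<lambda>t. pair_d2 C (\<lambda>l. w21 [l, j] q t) p) r
      = app_d3 C (\<lambda>t. - pair_d2 C (\<lambda>l. w21 [l, j] p t) q) r"
    using push assms(2,3) by (simp add: app_d3_linear pair_d2_linear)
qed

text \<open>The term of \<open>app_d3_w11\<close> with the factor d_1(e_l) contracts to
  d_1(d_2(f_p)) = 0; the other three remain.\<close>

lemma app_d3_w11_d2:
  assumes "{a, b, c} \<subseteq> {1..rk1 C}" "u \<in> {1..2}" "p \<in> {1..rk2 C}" "r \<in> {1..rk2 C}"
  shows "app_d3 C (\<lambda>t. pair_d2 C (\<lambda>l. w11 [a, b, c, l] u t) p) r =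
    df1 C u a * pair_d2 C (\<lambda>l. w31 [l, b, c] r) p - df1 C u b * pair_d2 C (\<lambda>l. w31 [l, a, c] r) p
    + df1 C u c * pair_d2 C (\<lambda>l. w31 [l, a, b] r) p"
proof -
  have "app_d3 C (\<lambda>t. pair_d2 C (\<lambda>l. w11 [a, b, c, l] u t) p) r =
    pair_d2 C (\<lambda>l. df1 C u a * w31 [l, b, c] r - df1 C u b * w31 [l, a, c] r
      + df1 C u c * w31 [l, a, b] r - df1 C u l * w31 [a, b, c] r) p"
    unfolding app_d3_pair_d2
  proof (rule pair_d2_cong)
    fix l assume "l \<in> {1..rk1 C}"
    then show "app_d3 C (w11 [a, b, c, l] u) r = df1 C u a * w31 [l, b, c] r
        - df1 C u b * w31 [l, a, c] r + df1 C u c * w31 [l, a, b] r - df1 C u l * w31 [a, b, c] r"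
      using assms alternating_3_rotate(1)[OF alternating_w31, of l b c r]
        alternating_3_rotate(1)[OF alternating_w31, of l a c r]
        alternating_3_rotate(1)[OF alternating_w31, of l a b r]
      by (simp add: app_d3_w11)
  qed
  then show ?thesis
    using acyclic3_d1_d2[OF acyclic assms(2,3)] by (simp add: pair_d2_linear)
qed

text \<open>Under d_3, the product of the minor of two columns with \<open>w31\<close> at d_2(f_p)
  and the two other basis elements arises on the left once from each of the two columns, hence the
  factor 2. The right side differs only by a multiple of the Pluecker relation.\<close>

lemma w11_d2:
  assumes "{a, b, c, d} \<subseteq> {1..rk1 C}" "p \<in> {1..rk2 C}" "t \<in> {1..rk3 C}"
  shows "pair_d2 C (\<lambda>l. - d1_wedge_w11 C w11 a [b, c, d, l] t + d1_wedge_w11 C w11 b [a, c, d, l] t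
      - d1_wedge_w11 C w11 c [a, b, d, l] t + d1_wedge_w11 C w11 d [a, b, c, l] t) p
    = 2 * (minor2 (df1 C) a b * w21 [c, d] p t - minor2 (df1 C) a c * w21 [b, d] p t
      + minor2 (df1 C) a d * w21 [b, c] p t + minor2 (df1 C) b c * w21 [a, d] p t
      - minor2 (df1 C) b d * w21 [a, c] p t + minor2 (df1 C) c d * w21 [a, b] p t)"
    (is "pair_d2 C (?L t) p = 2 * ?R t")
proof (rule acyclic3_d3_inj[OF acyclic _ assms(3)])
  fix r assume r: "r \<in> {1..rk2 C}"
  define V where "V = (\<lambda>i j. pair_d2 C (\<lambda>l. w31 [l, i, j] r) p)"
  define W where "W = (\<lambda>i j k u t. pair_d2 C (\<lambda>l. w11 [i, j, k, l] u t) p)"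
  define x where "x = df1 C"
  have dW: "app_d3 C (W i j k u) r = x u i * V j k - x u j * V i k + x u k * V i j"
    if "u \<in> {1..2}" "{i, j, k} \<subseteq> {a, b, c, d}" for i j k u
    unfolding W_def V_def x_def using that assms(1,2) r by (intro app_d3_w11_d2) auto
  have dB: "app_d3 C (w21 [i, j] p) r = minor2 x i j * of_bool (r = p) - V i j"
    if "{i, j} \<subseteq> {a, b, c, d}" for i j
    unfolding V_def x_def using that assms(1,2) r by (intro app_d3_w21) auto
  have "app_d3 C (\<lambda>t. pair_d2 C (?L t) p) r =
    - (x 1 a * app_d3 C (W b c d 2) r - x 2 a * app_d3 C (W b c d 1) r)
    + (x 1 b * app_d3 C (W a c d 2) r - x 2 b * app_d3 C (W a c d 1) r)
    - (x 1 c * app_d3 C (W a b d 2) r - x 2 c * app_d3 C (W a b d 1) r)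
    + (x 1 d * app_d3 C (W a b c 2) r - x 2 d * app_d3 C (W a b c 1) r)"
    by (simp add: d1_wedge_w11_def pair_d2_linear app_d3_linear W_def x_def)
  also have "\<dots> = - 2 * (minor2 x a b * V c d - minor2 x a c * V b d + minor2 x a d * V b c
      + minor2 x b c * V a d - minor2 x b d * V a c + minor2 x c d * V a b)"
    by (simp add: dW) (simp add: minor2_def algebra_simps)
  also have "\<dots> = 2 * (minor2 x a b * (minor2 x c d * of_bool (r = p) - V c d)
      - minor2 x a c * (minor2 x b d * of_bool (r = p) - V b d)
      + minor2 x a d * (minor2 x b c * of_bool (r = p) - V b c)
      + minor2 x b c * (minor2 x a d * of_bool (r = p) - V a d)
      - minor2 x b d * (minor2 x a c * of_bool (r = p) - V a c)
      + minor2 x c d * (minor2 x a b * of_bool (r = p) - V a b))"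
  proof -
    have "minor2 x a b * minor2 x c d - minor2 x a c * minor2 x b d + minor2 x a d * minor2 x b c = 0"
      by (simp add: minor2_def algebra_simps)
    \<comment> \<open>Stated for arbitrary elements in place of the minors, so that the Pluecker
      relation stays visible as a factor.\<close>
    moreover have "2 * (mab * (mcd * \<delta> - vcd) - mac * (mbd * \<delta> - vbd) + mad * (mbc * \<delta> - vbc)
        + mbc * (mad * \<delta> - vad) - mbd * (mac * \<delta> - vac) + mcd * (mab * \<delta> - vab)) =
        - 2 * (mab * vcd - mac * vbd + mad * vbc + mbc * vad - mbd * vac + mcd * vab)
        + 2 * \<delta> * (mab * mcd - mac * mbd + mad * mbc) + 2 * \<delta> * (mab * mcd - mac * mbd + mad * mbc)"
      for mab mac mad mbc mbd mcd vab vac vad vbc vbd vcd \<delta> :: 'a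
      by (simp add: algebra_simps)
    ultimately show ?thesis by simp
  qed
  also have "\<dots> = app_d3 C (\<lambda>t. 2 * ?R t) r"
    by (simp add: app_d3_linear dB flip: x_def)
  finally show "app_d3 C (\<lambda>t. pair_d2 C (?L t) p) r = app_d3 C (\<lambda>t. 2 * ?R t) r" .
qed

section \<open>Repeated basis elements in the second-level formulas\<close>

lemma alternating_d1_wedge_w11: "alternating 4 (rk1 C) (d1_wedge_w11 C w11 i)"
  using alternating_w11[of 1] alternating_w11[of 2]
  by (simp add: alternating_def d1_wedge_w11_def algebra_simps)

lemma d1_wedge_w11_d2:
  assumes "h \<in> {1..rk2 C}"
  shows "pair_d2 C (\<lambda>l. d1_wedge_w11 C w11 l xs t) h = 0"
  using acyclic3_d1_d2[OF acyclic _ assms] by (simp add: d1_wedge_w11_def pair_d2_linear)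

text \<open>Terms with both copies of \<open>l\<close> in one alternating factor vanish; the others
  cancel in pairs. As \<open>w222\<close> vanishes there too, its lifting equation can be summed
  over all \<open>l\<close>.\<close>

lemma q222_repeated:
  assumes "alternating 6 (rk1 C) (\<lambda>xs. w322 xs p)" "{a, b, c, d} \<subseteq> {1..rk1 C}"
    "l \<in> {a, b, c, d}" "h \<in> {1..rk2 C}"
  shows "q222 half C w31 w21 w11 w322 [a, b, c, d, l] h p t = 0"
proof -
  have "pair_d2 C (\<lambda>k. w322 [a, b, c, d, l, k] p t) h = pair_d2 C (\<lambda>k. 0) h"
    using assms(2,3)
    by (intro pair_d2_cong alternating_repeated[OF assms(1)]) auto
  then have w322_0: "pair_d2 C (\<lambda>k. w322 [a, b, c, d, l, k] p t) h = 0"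
    by (simp add: pair_d2_def)
  have w21_0: "w21 [i, i] h t = 0" if "i \<in> {1..rk1 C}" for i
    using alternating_repeated[OF alternating_w21] assms(4) that by auto
  have w11_0: "d1_wedge_w11 C w11 i xs t = 0"
    if "length xs = 4" "set xs \<subseteq> {1..rk1 C}" "\<not> distinct xs" for i xs
    using alternating_repeated[OF alternating_d1_wedge_w11] that by auto
  have "l = a \<or> l = b \<or> l = c \<or> l = d"
    using assms(3) by blast
  then show ?thesis
    using assms(2)
      alternating_2_swap[OF alternating_w21[OF assms(4)], of a b t]
      alternating_2_swap[OF alternating_w21[OF assms(4)], of a c t]
      alternating_2_swap[OF alternating_w21[OF assms(4)], of a d t]
      alternating_2_swap[OF alternating_w21[OF assms(4)], of b c t]
      alternating_2_swap[OF alternating_w21[OF assms(4)], of b d t]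
      alternating_2_swap[OF alternating_w21[OF assms(4)], of c d t]
      alternating_3_rotate(1)[OF alternating_w31, of a b c p]
      alternating_3_rotate(1)[OF alternating_w31, of a b d p]
      alternating_3_rotate(1)[OF alternating_w31, of a c d p]
      alternating_3_rotate(1)[OF alternating_w31, of b c d p]
      alternating_3_swap(2)[OF alternating_w31, of a b c p]
      alternating_3_swap(2)[OF alternating_w31, of a b d p]
      alternating_3_swap(2)[OF alternating_w31, of a c d p]
      alternating_3_swap(2)[OF alternating_w31, of b c d p]
      alternating_4_last[OF alternating_d1_wedge_w11, of a b c d _ t]
      alternating_4_swap(3)[OF alternating_d1_wedge_w11, of a b c d _ t]
    unfolding q222_expand w322_0
    by (elim disjE) (simp_all add: w31_repeated w21_0 w11_0)
qed

text \<open>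
  The formula for a new basis element also gives the one for a repeated element, so that \<open>w221\<close> can
  be contracted with \<open>d\<^sub>2\<close> in its second argument without distinguishing cases.
\<close>

lemma q221_new_repeated:
  assumes half: "2 * half = 1"
    and w321: "\<And>i. i \<in> {1..rk1 C} \<Longrightarrow> alternating 5 (rk1 C) (\<lambda>xs. w321 xs i p)"
    and "{a, b, c, d} \<subseteq> {1..rk1 C}" "h \<in> {1..rk2 C}"
  shows "q221_new half C w31 w21 w11 w321 [a, b, c, d] a h p t
      = q221_rep C w31 w21 w11 w321 a b c d h p t"
    and "q221_new half C w31 w21 w11 w321 [a, b, c, d] b h p t
      = - q221_rep C w31 w21 w11 w321 b a c d h p t"
    and "q221_new half C w31 w21 w11 w321 [a, b, c, d] c h p t
      = - q221_rep C w31 w21 w11 w321 c b a d h p t"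
    and "q221_new half C w31 w21 w11 w321 [a, b, c, d] d h p t
      = - q221_rep C w31 w21 w11 w321 d b c a h p t"
proof -
  have w321_0: "pair_d2 C (\<lambda>l. w321 [a, b, c, d, k] l p t) h = 0" if "k \<in> {a, b, c, d}" for k
  proof -
    have "pair_d2 C (\<lambda>l. w321 [a, b, c, d, k] l p t) h = pair_d2 C (\<lambda>l. 0) h"
      using assms(3) that
      by (intro pair_d2_cong alternating_repeated[OF w321]) auto
    then show ?thesis by (simp add: pair_d2_def)
  qed
  have w321_swap: "pair_d2 C (\<lambda>l. w321 [b, a, c, d, l] k p t) h = - pair_d2 C (\<lambda>l. w321 [a, b, c, d, l] k p t) h"
    "pair_d2 C (\<lambda>l. w321 [c, b, a, d, l] k p t) h = - pair_d2 C (\<lambda>l. w321 [a, b, c, d, l] k p t) h"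
    "pair_d2 C (\<lambda>l. w321 [d, b, c, a, l] k p t) h = - pair_d2 C (\<lambda>l. w321 [a, b, c, d, l] k p t) h"
    if "k \<in> {1..rk1 C}" for k
    unfolding pair_d2_linear(3)[symmetric]
    using assms(3) alternating_swap[OF w321[OF that], of "[a, b, c, d, _]" 0 1 t]
      alternating_swap[OF w321[OF that], of "[a, b, c, d, _]" 0 2 t]
      alternating_swap[OF w321[OF that], of "[a, b, c, d, _]" 0 3 t]
    by (intro pair_d2_cong; simp add: numeral_2_eq_2 numeral_3_eq_3)+
  have w11_0: "d1_wedge_w11 C w11 i xs t = 0"
    if "length xs = 4" "set xs \<subseteq> {1..rk1 C}" "\<not> distinct xs" for i xs
    using alternating_repeated[OF alternating_d1_wedge_w11] that by auto
  note rules =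
      alternating_2_swap[OF alternating_w21[OF assms(4)], of a b t]
      alternating_2_swap[OF alternating_w21[OF assms(4)], of a c t]
      alternating_2_swap[OF alternating_w21[OF assms(4)], of a d t]
      alternating_2_swap[OF alternating_w21[OF assms(4)], of b c t]
      alternating_2_swap[OF alternating_w21[OF assms(4)], of b d t]
      alternating_2_swap[OF alternating_w21[OF assms(4)], of c d t]
      alternating_3_rotate[OF alternating_w31, of a b c p]
      alternating_3_rotate[OF alternating_w31, of a b d p]
      alternating_3_rotate[OF alternating_w31, of a c d p]
      alternating_3_rotate[OF alternating_w31, of b c d p]
      alternating_3_swap[OF alternating_w31, of a b c p]
      alternating_3_swap[OF alternating_w31, of a b d p]
      alternating_3_swap[OF alternating_w31, of a c d p]
      alternating_3_swap[OF alternating_w31, of b c d p]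
      alternating_4_last[OF alternating_d1_wedge_w11, of a b c d _ t]
      alternating_4_swap[OF alternating_d1_wedge_w11, of a b c d _ t]
  \<comment> \<open>Three of the six products vanish because an index is repeated in
    \<open>w31\<close>. Two \<open>d1_wedge_w11\<close> terms survive and coincide, which absorbs
    \<open>half\<close>.\<close>
  show "q221_new half C w31 w21 w11 w321 [a, b, c, d] a h p t
      = q221_rep C w31 w21 w11 w321 a b c d h p t"
    "q221_new half C w31 w21 w11 w321 [a, b, c, d] b h p t
      = - q221_rep C w31 w21 w11 w321 b a c d h p t"
    "q221_new half C w31 w21 w11 w321 [a, b, c, d] c h p t
      = - q221_rep C w31 w21 w11 w321 c b a d h p t"
    "q221_new half C w31 w21 w11 w321 [a, b, c, d] d h p t
      = - q221_rep C w31 w21 w11 w321 d b c a h p t"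
    using rules assms(3)
    unfolding q221_new_expand q221_rep_def pair_d2_def[symmetric]
    by (simp_all add: w31_repeated w11_0 w321_0 w321_swap half_cancel[OF half] pair_d2_linear
        mult.assoc)
qed

section \<open>Contractions of the second-level maps with d_2\<close>

lemma w31_d2_last:
  assumes "{i, j} \<subseteq> {1..rk1 C}"
  shows "pair_d2 C (\<lambda>l. w31 [i, j, l] r) h = pair_d2 C (\<lambda>l. w31 [l, i, j] r) h"
  using assms by (intro pair_d2_cong alternating_3_rotate(1)[OF alternating_w31]) auto

lemma half_w11_d2:
  assumes "2 * half = 1" "{a, b, c, d} \<subseteq> {1..rk1 C}" "p \<in> {1..rk2 C}" "t \<in> {1..rk3 C}"
  shows "half * (- pair_d2 C (\<lambda>l. d1_wedge_w11 C w11 a [b, c, d, l] t) p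
      + pair_d2 C (\<lambda>l. d1_wedge_w11 C w11 b [a, c, d, l] t) p
      - pair_d2 C (\<lambda>l. d1_wedge_w11 C w11 c [a, b, d, l] t) p
      + pair_d2 C (\<lambda>l. d1_wedge_w11 C w11 d [a, b, c, l] t) p)
    = minor2 (df1 C) a b * w21 [c, d] p t - minor2 (df1 C) a c * w21 [b, d] p t
      + minor2 (df1 C) a d * w21 [b, c] p t + minor2 (df1 C) b c * w21 [a, d] p t
      - minor2 (df1 C) b d * w21 [a, c] p t + minor2 (df1 C) c d * w21 [a, b] p t"
    (is "_ * ?L = ?R")
proof -
  have "?L = 2 * ?R"
    using w11_d2[OF assms(2-4)] by (simp only: pair_d2_linear)
  then show ?thesis
    by (simp only: half_cancel[OF assms(1)])
qed

text \<open>Here and in \<open>q222_d2\<close>, the \<open>d1_wedge_w11\<close> term whose first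
  index is contracted vanishes by d_1 d_2 = 0, and the other four give the minors by
  \<open>half_w11_d2\<close>.\<close>

lemma q221_new_d2:
  assumes "2 * half = 1" "{a, b, c, d} \<subseteq> {1..rk1 C}" "p \<in> {1..rk2 C}" "t \<in> {1..rk3 C}"
    "q \<in> {1..rk2 C}" "r \<in> {1..rk2 C}"
  shows "pair_d2 C (\<lambda>l. q221_new half C w31 w21 w11 w321 [a, b, c, d] l q r t) p =
      pair_d2 C (\<lambda>l. w31 [l, a, b] r) p * w21 [c, d] q t
      - pair_d2 C (\<lambda>l. w31 [l, a, c] r) p * w21 [b, d] q t
      + pair_d2 C (\<lambda>l. w31 [l, a, d] r) p * w21 [b, c] q t
      + pair_d2 C (\<lambda>l. w31 [l, b, c] r) p * w21 [a, d] q t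
      - pair_d2 C (\<lambda>l. w31 [l, b, d] r) p * w21 [a, c] q t
      + pair_d2 C (\<lambda>l. w31 [l, c, d] r) p * w21 [a, b] q t
      + of_bool (r = q) *
        (minor2 (df1 C) a b * w21 [c, d] p t - minor2 (df1 C) a c * w21 [b, d] p t
        + minor2 (df1 C) a d * w21 [b, c] p t + minor2 (df1 C) b c * w21 [a, d] p t
        - minor2 (df1 C) b d * w21 [a, c] p t + minor2 (df1 C) c d * w21 [a, b] p t)
      + pair_d2 C (\<lambda>l. pair_d2 C (\<lambda>k. w321 [a, b, c, d, k] l r t + w321 [a, b, c, d, l] k r t) q) p"
  unfolding half_w11_d2[OF assms(1-4), symmetric]
  using assms(2)
  by (simp add: q221_new_expand pair_d2_linear w31_d2_last d1_wedge_w11_d2[OF assms(3)])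

lemma q222_d2:
  assumes "2 * half = 1" "{a, b, c, d} \<subseteq> {1..rk1 C}" "p \<in> {1..rk2 C}" "t \<in> {1..rk3 C}"
    "q \<in> {1..rk2 C}" "r \<in> {1..rk2 C}"
  shows "pair_d2 C (\<lambda>l. q222 half C w31 w21 w11 w322 [a, b, c, d, l] q r t) p =
      - w31 [a, b, c] r * pair_d2 C (\<lambda>l. w21 [d, l] q t) p
      + w31 [a, b, d] r * pair_d2 C (\<lambda>l. w21 [c, l] q t) p
      - w31 [a, c, d] r * pair_d2 C (\<lambda>l. w21 [b, l] q t) p
      + w31 [b, c, d] r * pair_d2 C (\<lambda>l. w21 [a, l] q t) p
      - pair_d2 C (\<lambda>l. w31 [l, a, b] r) p * w21 [c, d] q t
      + pair_d2 C (\<lambda>l. w31 [l, a, c] r) p * w21 [b, d] q t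
      - pair_d2 C (\<lambda>l. w31 [l, a, d] r) p * w21 [b, c] q t
      - pair_d2 C (\<lambda>l. w31 [l, b, c] r) p * w21 [a, d] q t
      + pair_d2 C (\<lambda>l. w31 [l, b, d] r) p * w21 [a, c] q t
      - pair_d2 C (\<lambda>l. w31 [l, c, d] r) p * w21 [a, b] q t
      + of_bool (r = q) *
        (minor2 (df1 C) a b * w21 [c, d] p t - minor2 (df1 C) a c * w21 [b, d] p t
        + minor2 (df1 C) a d * w21 [b, c] p t + minor2 (df1 C) b c * w21 [a, d] p t
        - minor2 (df1 C) b d * w21 [a, c] p t + minor2 (df1 C) c d * w21 [a, b] p t)
      - pair_d2 C (\<lambda>l. pair_d2 C (\<lambda>k. w322 [a, b, c, d, l, k] r t) q) p"
  unfolding half_w11_d2[OF assms(1-4), symmetric]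
  using assms(2)
  by (simp add: q222_expand pair_d2_linear w31_d2_last d1_wedge_w11_d2[OF assms(3)])

lemma w21_d2_skew':
  assumes "j \<in> {1..rk1 C}" "p \<in> {1..rk2 C}" "q \<in> {1..rk2 C}" "t \<in> {1..rk3 C}"
  shows "pair_d2 C (\<lambda>l. w21 [j, l] q t) p = - pair_d2 C (\<lambda>l. w21 [j, l] p t) q"
proof -
  have "pair_d2 C (\<lambda>l. w21 [j, l] q t) p = - pair_d2 C (\<lambda>l. w21 [l, j] q t) p"
    if "q \<in> {1..rk2 C}" for p q
    unfolding pair_d2_linear(3)[symmetric] using assms(1) that
    by (intro pair_d2_cong alternating_2_swap[OF alternating_w21]) auto
  then show ?thesis
    using w21_d2_skew[OF assms] assms(2,3) by (simp only:)
qed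

text \<open>For \<open>l\<close> among the entries, a transposition moves it to the front, where
  \<open>q221_rep\<close> applies; \<open>q221_new_repeated\<close> translates the result back. One
  formula then serves for the whole contraction.\<close>

lemma w221_lifts_q221_new:
  assumes half: "2 * half = 1" and w321: "is_w321 C w31 w321"
    and w221: "is_w221 half C w31 w21 w11 w321 w221"
    and xs: "wedge_args (rk1 C) 4 [a, b, c, d]"
    and l: "l \<in> {1..rk1 C}" and h: "h \<in> {1..rk2 C}"
  shows "lifts_wedge3 C (w221 [a, b, c, d] l h) (q221_new half C w31 w21 w11 w321 [a, b, c, d] l h)"
proof (cases "l \<in> {a, b, c, d}")
  case False
  then show ?thesis
    using w221 h xs l by (auto simp: is_w221_def wedge_args_def)
next
  case True
  have sub: "{a, b, c, d} \<subseteq> {1..rk1 C}"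
    using xs by (auto simp: wedge_args_def)
  have rep: "lifts_wedge3 C (w221 [a', b', c', d'] a' h) (q221_rep C w31 w21 w11 w321 a' b' c' d' h)"
    if "wedge_args (rk1 C) 4 [a', b', c', d']" for a' b' c' d'
    using w221 h that unfolding is_w221_def by blast
  have alt: "alternating 4 (rk1 C) (\<lambda>xs. w221 xs l h t)" if "t \<in> {1..rk3 C}" for t
    using w221 l h that unfolding is_w221_def by blast
  have w321_alt: "alternating 5 (rk1 C) (\<lambda>xs. w321 xs i p)"
    if "i \<in> {1..rk1 C}" "p \<in> {1..rk2 C}" for i p
    using w321 that unfolding is_w321_def by blast
  note expand = q221_new_repeated[OF half w321_alt sub h]
  \<comment> \<open>\<open>sg\<close> is the sign of the permutation that brings \<open>l\<close> to
    the front.\<close>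
  have lift: "lifts_wedge3 C (w221 [a, b, c, d] l h) (q221_new half C w31 w21 w11 w321 [a, b, c, d] l h)"
    if "wedge_args (rk1 C) 4 [l, b', c', d']"
      "\<And>t s. t \<in> {1..rk3 C} \<Longrightarrow> w221 [a, b, c, d] l h t s = sg * w221 [l, b', c', d'] l h t s"
      "\<And>p t. p \<in> {1..rk2 C} \<Longrightarrow> q221_new half C w31 w21 w11 w321 [a, b, c, d] l h p t
        = sg * q221_rep C w31 w21 w11 w321 l b' c' d' h p t" for b' c' d' sg
    using rep[OF that(1)]
    by (rule lifts_wedge3_scale[where c = sg]) (rule that(2), assumption, rule that(3), assumption)
  consider "l = a" | "l = b" | "l = c" | "l = d" using True by blast
  then show ?thesis
  proof cases
    case 1
    show ?thesis
      by (rule lift[where sg = 1 and b' = b and c' = c and d' = d]) (use xs 1 expand(1) in simp_all)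
  next
    case 2
    have "wedge_args (rk1 C) 4 [l, a, c, d]"
      using xs 2 by (auto simp: wedge_args_def)
    then show ?thesis
      by (rule lift[where sg = "- 1"]) (use 2 expand(2) alternating_4_swap(1)[OF alt sub] in simp_all)
  next
    case 3
    have "wedge_args (rk1 C) 4 [l, b, a, d]"
      using xs 3 by (auto simp: wedge_args_def)
    then show ?thesis
      by (rule lift[where sg = "- 1"]) (use 3 expand(3) alternating_4_swap(4)[OF alt sub] in simp_all)
  next
    case 4
    have "wedge_args (rk1 C) 4 [l, b, c, a]"
      using xs 4 by (auto simp: wedge_args_def)
    then show ?thesis
      by (rule lift[where sg = "- 1"]) (use 4 expand(4) alternating_4_swap(5)[OF alt sub] in simp_all)
  qed
qed

text \<open>Under d_3 the \<open>w321\<close> terms cancel in the difference. The rest is what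
  \<open>app_d3_w21\<close> gives on the right, where d_3 acts on one factor of each
  product.\<close>

lemma w221_d2:
  assumes half: "2 * half = 1" and w321: "is_w321 C w31 w321"
    and w221: "is_w221 half C w31 w21 w11 w321 w221"
    and xs: "wedge_args (rk1 C) 4 [a, b, c, d]"
    and p: "p \<in> {1..rk2 C}" and q: "q \<in> {1..rk2 C}" and t: "t \<in> {1..rk3 C}" and s: "s \<in> {1..rk3 C}"
  shows "pair_d2 C (\<lambda>l. w221 [a, b, c, d] l q t s) p - pair_d2 C (\<lambda>l. w221 [a, b, c, d] l p t s) q =
      w21 [a, b] p s * w21 [c, d] q t - w21 [a, b] p t * w21 [c, d] q s
      - (w21 [a, c] p s * w21 [b, d] q t - w21 [a, c] p t * w21 [b, d] q s)
      + (w21 [a, d] p s * w21 [b, c] q t - w21 [a, d] p t * w21 [b, c] q s)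
      + (w21 [b, c] p s * w21 [a, d] q t - w21 [b, c] p t * w21 [a, d] q s)
      - (w21 [b, d] p s * w21 [a, c] q t - w21 [b, d] p t * w21 [a, c] q s)
      + (w21 [c, d] p s * w21 [a, b] q t - w21 [c, d] p t * w21 [a, b] q s)"
    (is "?L t = ?R t")
proof (rule acyclic3_d3_inj[OF acyclic _ t])
  fix r assume r: "r \<in> {1..rk2 C}"
  have sub: "{a, b, c, d} \<subseteq> {1..rk1 C}"
    using xs by (auto simp: wedge_args_def)
  have push: "app_d3 C (\<lambda>t. pair_d2 C (\<lambda>l. w221 [a, b, c, d] l q t s) p) r
      = pair_d2 C (\<lambda>l. q221_new half C w31 w21 w11 w321 [a, b, c, d] l q r s) p"
    if "q \<in> {1..rk2 C}" for p q
    unfolding app_d3_pair_d2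
  proof (rule pair_d2_cong)
    fix l assume "l \<in> {1..rk1 C}"
    then show "app_d3 C (\<lambda>t. w221 [a, b, c, d] l q t s) r
        = q221_new half C w31 w21 w11 w321 [a, b, c, d] l q r s"
      using lifts_wedge3_image[OF w221_lifts_q221_new[OF half w321 w221 xs _ that] r s] by blast
  qed
  \<comment> \<open>The form adds the two orders of \<open>k\<close> and \<open>l\<close>, hence is
    symmetric.\<close>
  have sym: "pair_d2 C (\<lambda>l. pair_d2 C (\<lambda>k. w321 [a, b, c, d, k] l r s + w321 [a, b, c, d, l] k r s) q) p
      = pair_d2 C (\<lambda>l. pair_d2 C (\<lambda>k. w321 [a, b, c, d, k] l r s + w321 [a, b, c, d, l] k r s) p) q"
    by (subst pair_d2_swap) (simp add: add.commute)
  show "app_d3 C ?L r = app_d3 C ?R r"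
    unfolding app_d3_linear push[OF p] push[OF q] q221_new_d2[OF half sub p s q r]
      q221_new_d2[OF half sub q s p r] sym
    using sub p q r by (simp add: app_d3_w21 algebra_simps)
qed

text \<open>In the sum of the two contractions the \<open>w322\<close> terms cancel because their
  double contraction is skew, and the products of \<open>w31\<close> with a contracted
  \<open>w21\<close> cancel by \<open>w21_d2_skew'\<close>. What remains is d_3 of the polarized
  Pfaffian expression.\<close>

lemma w222_d2:
  assumes half: "2 * half = 1" and w322: "is_w322 C w31 w322"
    and w222: "is_w222 half C w31 w21 w11 w322 w222"
    and xs: "wedge_args (rk1 C) 4 [a, b, c, d]"
    and p: "p \<in> {1..rk2 C}" and q: "q \<in> {1..rk2 C}" and s: "s \<in> {1..rk3 C}"
  shows "pair_d2 C (\<lambda>l. w222 [a, b, c, d, l] q s s) p + pair_d2 C (\<lambda>l. w222 [a, b, c, d, l] p s s) q =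
      w21 [a, b] p s * w21 [c, d] q s + w21 [c, d] p s * w21 [a, b] q s
      - (w21 [a, c] p s * w21 [b, d] q s + w21 [b, d] p s * w21 [a, c] q s)
      + (w21 [a, d] p s * w21 [b, c] q s + w21 [b, c] p s * w21 [a, d] q s)"
    (is "?l = ?r")
proof -
  \<comment> \<open>the factor of the diagonal coefficients in \<open>lifts_sym3\<close>\<close>
  define m where "m t = (if t = s then 2 else 1 :: 'a)" for t
  define L where "L = (\<lambda>t. pair_d2 C (\<lambda>l. m t * w222 [a, b, c, d, l] q t s) p
      + pair_d2 C (\<lambda>l. m t * w222 [a, b, c, d, l] p t s) q)"
  \<comment> \<open>Each product of the claim is polarized in \<open>t\<close> and \<open>s\<close>.
    At \<open>t = s\<close> it occurs twice, matching the factor 2 that \<open>m\<close> puts on the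
    left.\<close>
  define R where "R = (\<lambda>t.
      w21 [a, b] p t * w21 [c, d] q s + w21 [c, d] q t * w21 [a, b] p s
      - (w21 [a, c] p t * w21 [b, d] q s + w21 [b, d] q t * w21 [a, c] p s)
      + (w21 [a, d] p t * w21 [b, c] q s + w21 [b, c] q t * w21 [a, d] p s)
      + (w21 [b, c] p t * w21 [a, d] q s + w21 [a, d] q t * w21 [b, c] p s)
      - (w21 [b, d] p t * w21 [a, c] q s + w21 [a, c] q t * w21 [b, d] p s)
      + (w21 [c, d] p t * w21 [a, b] q s + w21 [a, b] q t * w21 [c, d] p s))"
  have sub: "{a, b, c, d} \<subseteq> {1..rk1 C}"
    using xs by (auto simp: wedge_args_def)
  have w322_alt: "alternating 6 (rk1 C) (\<lambda>xs. w322 xs r)" if "r \<in> {1..rk2 C}" for r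
    using w322 that by (simp add: is_w322_def)
  have lift: "app_d3 C (\<lambda>t. m t * w222 [a, b, c, d, l] q t s) r
      = q222 half C w31 w21 w11 w322 [a, b, c, d, l] q r s"
    if l: "l \<in> {1..rk1 C}" and q: "q \<in> {1..rk2 C}" and r: "r \<in> {1..rk2 C}" for l q r
  proof (cases "l \<in> {a, b, c, d}")
    case True
    have "w222 [a, b, c, d, l] q t s = 0" if "t \<in> {1..rk3 C}" for t
      using w222 q that l sub True
        alternating_repeated[of 5 "rk1 C" "\<lambda>xs. w222 xs q t" "[a, b, c, d, l]" s]
      unfolding is_w222_def by auto
    then show ?thesis
      using q222_repeated[where ?w322.0 = w322, OF w322_alt[OF r] sub True q] by (simp add: app_d3_def)
  next
    case False
    then have "wedge_args (rk1 C) 5 [a, b, c, d, l]"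
      using xs l by (auto simp: wedge_args_def)
    then have "lifts_sym3 C (w222 [a, b, c, d, l] q) (q222 half C w31 w21 w11 w322 [a, b, c, d, l] q)"
      using w222 q unfolding is_w222_def by blast
    then have "(\<Sum>t=1..rk3 C. df3 C r t * (if t = s then 2 * w222 [a, b, c, d, l] q t s
        else w222 [a, b, c, d, l] q t s)) = q222 half C w31 w21 w11 w322 [a, b, c, d, l] q r s"
      using r s unfolding lifts_sym3_def by blast
    moreover have "m t * w222 [a, b, c, d, l] q t s =
        (if t = s then 2 * w222 [a, b, c, d, l] q t s else w222 [a, b, c, d, l] q t s)" for t
      by (simp add: m_def)
    ultimately show ?thesis by (simp add: app_d3_def)
  qed
  have "L s = R s"
  proof (rule acyclic3_d3_inj[OF acyclic _ s])
    fix r assume r: "r \<in> {1..rk2 C}"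
    have push: "app_d3 C (\<lambda>t. pair_d2 C (\<lambda>l. m t * w222 [a, b, c, d, l] q t s) p) r
        = pair_d2 C (\<lambda>l. q222 half C w31 w21 w11 w322 [a, b, c, d, l] q r s) p"
      if "q \<in> {1..rk2 C}" for p q
      unfolding app_d3_pair_d2 using lift[OF _ that r] by (rule pair_d2_cong)
    have "pair_d2 C (\<lambda>l. pair_d2 C (\<lambda>k. w322 [a, b, c, d, l, k] r s) q) p
        = pair_d2 C (\<lambda>l. pair_d2 C (\<lambda>k. - w322 [a, b, c, d, l, k] r s) p) q"
    proof (subst pair_d2_swap, intro pair_d2_cong)
      fix l k assume "l \<in> {1..rk1 C}" "k \<in> {1..rk1 C}"
      then show "w322 [a, b, c, d, k, l] r s = - w322 [a, b, c, d, l, k] r s"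
        using alternating_swap[OF w322_alt[OF r], of "[a, b, c, d, l, k]" 4 5 s] sub
        by (simp add: numeral_eq_Suc)
    qed
    then have skew: "pair_d2 C (\<lambda>l. pair_d2 C (\<lambda>k. w322 [a, b, c, d, l, k] r s) q) p
        = - pair_d2 C (\<lambda>l. pair_d2 C (\<lambda>k. w322 [a, b, c, d, l, k] r s) p) q"
      by (simp add: pair_d2_linear)
    have w21_skew: "pair_d2 C (\<lambda>l. w21 [j, l] q s) p = - pair_d2 C (\<lambda>l. w21 [j, l] p s) q"
      if "j \<in> {a, b, c, d}" for j
      using that sub p q s by (intro w21_d2_skew') auto
    show "app_d3 C L r = app_d3 C R r"
      unfolding L_def R_def app_d3_linear push[OF p] push[OF q] q222_d2[OF half sub p s q r]
        q222_d2[OF half sub q s p r] skew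
      using sub p q r by (simp add: app_d3_w21 w21_skew algebra_simps)
  qed
  have L: "L s = 2 * ?l" and R: "R s = 2 * ?r"
    by (simp_all add: L_def R_def m_def pair_d2_linear algebra_simps)
  have "half * (2 * ?l) = half * (2 * ?r)"
    using \<open>L s = R s\<close> by (simp only: L R)
  then show ?thesis
    by (simp only: half_cancel[OF half])
qed

end

theorem theorem3p8:
  fixes m :: "'a::comm_ring_1 set"
    and \<pi> :: "nat \<Rightarrow> 'a \<Rightarrow> 'a"
    and half :: 'a
    and A D :: "'a complex3"
    and w31 wD :: "nat list \<Rightarrow> nat \<Rightarrow> 'a"
    and w21 w11 w322 :: "nat list \<Rightarrow> nat \<Rightarrow> nat \<Rightarrow> 'a"
    and w321 w222 :: "nat list \<Rightarrow> nat \<Rightarrow> nat \<Rightarrow> nat \<Rightarrow> 'a"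
    and w221 :: "nat list \<Rightarrow> nat \<Rightarrow> nat \<Rightarrow> nat \<Rightarrow> nat \<Rightarrow> 'a"
  assumes gorenstein: "gorenstein_ring TYPE('a)"
    and local_or_graded: "local_ring_with m \<or> graded_ring_with \<pi> m \<and> homogeneous3 \<pi> A"
    and residue_field: "infinite (carrier (ring_of_type_algebra Quot m))"
    and half: "2 * half = 1"
    and rank_cases: "(rk1 A, rk2 A, rk3 A) = (6, 5, 1) \<or> (rk1 A, rk2 A, rk3 A) = (5, 5, 2)"
    and resolution: "acyclic3 A"
    and minimal: "minimal3 m A"
    and perfect: "perfect_coker 2 (rk1 A) (df1 A)"
    and height: "ideal_height (br_ideal A) = 3"
    and w31: "is_w31 A w31"
    and w21: "is_w21 A w31 w21"
    and w11: "is_w11 A w31 w11"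
    and w321: "is_w321 A w31 w321"
    and w322: "is_w322 A w31 w322"
    and w221: "rk3 A = 2 \<Longrightarrow> is_w221 half A w31 w21 w11 w321 w221"
    and w222: "is_w222 half A w31 w21 w11 w322 w222"
    and D: "D = linked_complex A w31 w11"
    and wD: "is_linked_w31 A w21 w221 wD"
  shows "(\<forall>t\<in>{1..rk3 A}. \<forall>j\<in>{1..4}.
            w321_value D wD [1, 2, 3, 4, 4 + t] j (\<lambda>h k. w21 [4 + k, j] h t)) \<and>
         (\<forall>t\<in>{1..rk3 A}.
            w321_value D wD [1, 2, 3, 4, 4 + t] 5 (\<lambda>h k. w222 [1, 2, 3, 4, 4 + k] h t t)) \<and>
         (\<forall>t\<in>{1..rk3 A}. \<forall>s\<in>{1..rk3 A}. t \<noteq> s \<longrightarrow>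
            w322_value D wD [1, 2, 3, 4, 4 + t, 4 + s] (\<lambda>h k. w221 [1, 2, 3, 4] (4 + k) h t s))"
proof -
  interpret structure_maps A w31 w21 w11
    using resolution w31 w21 w11 by unfold_locales
  have rk: "4 \<le> rk1 A"
    using rank_cases by auto
  have ranks_D: "rk2 D = rk2 A" "rk3 D = rk1 A - 4"
    by (simp_all add: D linked_complex_def)
  have args: "wedge_args (rk1 A) 4 [1, 2, 3, 4]"
    using rk by (auto simp: wedge_args_def)
  note push3_D = push3_linked_complex[OF rk, of w31 w11, folded D]

  \<comment> \<open>Values of \<open>w31\<close> of the linked complex on triples of basis
    elements\<close>
  have wD_alt: "alternating 3 (rk3 A + 4) wD"
    and wD_lt: "\<And>i j k r h. i < j \<Longrightarrow> j < k \<Longrightarrow> {i, j, k, r} = {1, 2, 3, 4} \<Longrightarrow> h \<in> {1..rk2 A} \<Longrightarrow>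
        wD [i, j, k] h = (-1) ^ r * df2 A r h"
    and wD_ssg: "\<And>i j t h. i \<in> {1..4} \<Longrightarrow> j \<in> {1..4} \<Longrightarrow> t \<in> {1..rk3 A} \<Longrightarrow> h \<in> {1..rk2 A} \<Longrightarrow>
        wD [i, j, 4 + t] h = w21 [i, j] h t"
    and wD_sgg: "\<And>i t s h. i \<in> {1..4} \<Longrightarrow> t \<in> {1..rk3 A} \<Longrightarrow> s \<in> {1..rk3 A} \<Longrightarrow> t \<noteq> s \<Longrightarrow>
        h \<in> {1..rk2 A} \<Longrightarrow> wD [i, 4 + t, 4 + s] h = w221 [1, 2, 3, 4] i h t s"
    using wD unfolding is_linked_w31_def by blast+
  have wD_sss: "wD [1, 2, 3] h = df2 A 4 h" "wD [1, 2, 4] h = - df2 A 3 h"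
    "wD [1, 3, 4] h = df2 A 2 h" "wD [2, 3, 4] h = - df2 A 1 h" if "h \<in> {1..rk2 A}" for h
  proof -
    have "{1, 2, 4, 3} = {1, 2, 3, 4::nat}" "{1, 3, 4, 2} = {1, 2, 3, 4::nat}"
      "{2, 3, 4, 1} = {1, 2, 3, 4::nat}"
      by auto
    then show "wD [1, 2, 3] h = df2 A 4 h" "wD [1, 2, 4] h = - df2 A 3 h"
      "wD [1, 3, 4] h = df2 A 2 h" "wD [2, 3, 4] h = - df2 A 1 h"
      using wD_lt[of 1 2 3 4 h] wD_lt[of 1 2 4 3 h] wD_lt[of 1 3 4 2 h] wD_lt[of 2 3 4 1 h] that
      by (simp_all del: One_nat_def)
  qed
  have wD_perm: "wD [j, i, k] h = - wD [i, j, k] h" "wD [k, i, j] h = wD [i, j, k] h"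
    if "i \<in> {1..4 + rk3 A}" "j \<in> {1..4 + rk3 A}" "k \<in> {1..4 + rk3 A}" for i j k h
    using that alternating_3_swap[OF wD_alt, of i j k] alternating_3_rotate[OF wD_alt, of i j k]
    by auto
  \<comment> \<open>\<open>q321\<close> puts the repeated basis element first, so triples occur out
    of order.\<close>
  have wD_sss_perm: "wD [2, 1, 3] h = - df2 A 4 h" "wD [2, 1, 4] h = df2 A 3 h"
    "wD [3, 1, 2] h = df2 A 4 h" "wD [3, 1, 4] h = - df2 A 2 h" "wD [3, 2, 4] h = df2 A 1 h"
    "wD [4, 1, 2] h = - df2 A 3 h" "wD [4, 1, 3] h = df2 A 2 h" "wD [4, 2, 3] h = - df2 A 1 h"
    if "h \<in> {1..rk2 A}" for h
    using that wD_perm(1)[of 1 2 3 h] wD_perm(1)[of 1 2 4 h] wD_perm(2)[of 1 2 3 h]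
      wD_perm(1)[of 1 3 4 h] wD_perm(1)[of 2 3 4 h] wD_perm(2)[of 1 2 4 h] wD_perm(2)[of 1 3 4 h]
      wD_perm(2)[of 2 3 4 h]
    by (simp_all add: wD_sss del: One_nat_def)

  \<comment> \<open>The formula for s_j as the repeated element\<close>
  have "w321_value D wD [1, 2, 3, 4, 4 + t] j (\<lambda>h k. w21 [4 + k, j] h t)"
    if t: "t \<in> {1..rk3 A}" and j: "j \<in> {1..4}" for t j
    unfolding w321_value_def lifts_sym2_def
  proof (intro ballI sym2_eqI[OF half])
    fix p q assume "p \<in> {1..rk2 D}" "q \<in> {1..rk2 D}"
    then have pq: "p \<in> {1..rk2 A}" "q \<in> {1..rk2 A}"
      by (simp_all add: ranks_D)
    have j': "j \<in> {1..rk1 A}"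
      using j rk by auto
    have w21_anti: "w21 [l, i] h t = - w21 [i, l] h t" if "i < l" "{i, l} \<subseteq> {1..4}" "h \<in> {1..rk2 A}" for i l h
      using rk that by (intro alternating_2_swap[OF alternating_w21]) auto
    have w21_0: "w21 [i, i] h t = 0" if "i \<in> {1..4}" "h \<in> {1..rk2 A}" for i h
      using alternating_repeated[OF alternating_w21] rk that by auto
    let ?S = "push3 D (\<lambda>h k. w21 [4 + k, j] h t)"
    let ?T = "\<lambda>p q. (-1) ^ (j + 1) * q321 wD (nth1 [1, 2, 3, 4, 4 + t] j) (omit {j} [1, 2, 3, 4, 4 + t]) p q"
    \<comment> \<open>The full contractions cancel by \<open>w21_d2_skew\<close>; only the
      correction by the rows 1 to 4 of d_2 survives. In \<open>q321\<close> these rows are the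
      values of \<open>wD\<close> on triples of the s_i.\<close>
    have "?S p q + ?S q p = - (df2 A 1 p * w21 [1, j] q t + df2 A 2 p * w21 [2, j] q t
        + df2 A 3 p * w21 [3, j] q t + df2 A 4 p * w21 [4, j] q t)
        - (df2 A 1 q * w21 [1, j] p t + df2 A 2 q * w21 [2, j] p t
        + df2 A 3 q * w21 [3, j] p t + df2 A 4 q * w21 [4, j] p t)"
      using w21_d2_skew[OF j' pq t] push3_D[of "\<lambda>h k. w21 [k, j] h t"] by simp
    also have "\<dots> = ?T p q + ?T q p"
    proof -
      consider "j = 1" | "j = 2" | "j = 3" | "j = 4"
        using j by fastforce
      then show ?thesis
        using pq t by cases
          (simp_all add: q321_def omit_Cons nth1_Cons wD_sss wD_sss_perm wD_ssg w21_anti w21_0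
            del: One_nat_def)
    qed
    finally show "?S p q + ?S q p = ?T p q + ?T q p" .
  qed

  \<comment> \<open>The formula for gamma_t as the repeated element\<close>
  moreover have "w321_value D wD [1, 2, 3, 4, 4 + t] 5 (\<lambda>h k. w222 [1, 2, 3, 4, 4 + k] h t t)"
    if t: "t \<in> {1..rk3 A}" for t
    unfolding w321_value_def lifts_sym2_def
  proof (intro ballI sym2_eqI[OF half])
    fix p q assume "p \<in> {1..rk2 D}" "q \<in> {1..rk2 D}"
    then have pq: "p \<in> {1..rk2 A}" "q \<in> {1..rk2 A}"
      by (simp_all add: ranks_D)
    have w222_0: "w222 [1, 2, 3, 4, l] h t t = 0" if "l \<in> {1..4}" "h \<in> {1..rk2 A}" for l h
    proof -
      have "alternating 5 (rk1 A) (\<lambda>xs. w222 xs h t)"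
        using w222 that(2) t unfolding is_w222_def by blast
      moreover have "l \<in> {1, 2, 3, 4}"
        using that(1) by auto
      ultimately show ?thesis
        using alternating_repeated[of 5 "rk1 A" "\<lambda>xs. w222 xs h t" "[1, 2, 3, 4, l]" t] rk that(1) by auto
    qed
    have wD_gss: "wD [4 + t, i, j] h = w21 [i, j] h t" if "i \<in> {1..4}" "j \<in> {1..4}" "h \<in> {1..rk2 A}" for i j h
      using wD_perm(2)[of i j "4 + t"] wD_ssg[OF that(1,2) t that(3)] that(1,2) t by auto
    let ?S = "push3 D (\<lambda>h k. w222 [1, 2, 3, 4, 4 + k] h t t)"
    let ?T = "\<lambda>p q. (-1) ^ (5 + 1) * q321 wD (nth1 [1, 2, 3, 4, 4 + t] 5) (omit {5} [1, 2, 3, 4, 4 + t]) p q"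
    \<comment> \<open>The correction by the rows 1 to 4 is zero here, since \<open>w222\<close>
      vanishes on a repeated index.\<close>
    have S: "?S p q = pair_d2 A (\<lambda>l. w222 [1, 2, 3, 4, l] q t t) p"
      if "q \<in> {1..rk2 A}" for p q
      using push3_D[of "\<lambda>h l. w222 [1, 2, 3, 4, l] h t t" p q] w222_0[OF _ that]
      by (simp del: One_nat_def)
    have T: "?T p q = w21 [1, 2] p t * w21 [3, 4] q t - w21 [1, 3] p t * w21 [2, 4] q t
        + w21 [1, 4] p t * w21 [2, 3] q t" if "p \<in> {1..rk2 A}" "q \<in> {1..rk2 A}" for p q
      using that by (simp add: q321_def omit_Cons nth1_Cons wD_gss del: One_nat_def)
    show "?S p q + ?S q p = ?T p q + ?T q p"
      unfolding S[OF pq(1)] S[OF pq(2)] T[OF pq] T[OF pq(2,1)] w222_d2[OF half w322 w222 args pq t]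
      by (simp only: algebra_simps)
  qed

  \<comment> \<open>The formula for \<open>w322\<close> with two elements gamma_t, gamma_s\<close>
  moreover have "w322_value D wD [1, 2, 3, 4, 4 + t, 4 + s] (\<lambda>h k. w221 [1, 2, 3, 4] (4 + k) h t s)"
    if t: "t \<in> {1..rk3 A}" and s: "s \<in> {1..rk3 A}" and "t \<noteq> s" for t s
    unfolding w322_value_def lifts_alt2_def
  proof (intro ballI)
    fix p q assume "p \<in> {1..rk2 D}" "q \<in> {1..rk2 D}"
    then have pq: "p \<in> {1..rk2 A}" "q \<in> {1..rk2 A}"
      by (simp_all add: ranks_D)
    have "rk3 A = 2"
      using rank_cases t s \<open>t \<noteq> s\<close> by auto
    note w221 = w221[OF this]
    let ?w = "\<lambda>l h. w221 [1, 2, 3, 4] l h t s"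
    let ?B = "\<lambda>i j. w21 [i, j]"
    \<comment> \<open>Six terms pair two values of \<open>wD\<close> with one gamma each. The other
      four pair a triple of s_i with a triple containing both gammas; after skew-symmetrization they
      match the correction by the rows 1 to 4 in \<open>push3_D\<close>.\<close>
    have T: "q322 wD [1, 2, 3, 4, 4 + t, 4 + s] p q =
        ?B 1 2 p s * ?B 3 4 q t - ?B 1 3 p s * ?B 2 4 q t + ?B 1 4 p s * ?B 2 3 q t
        + ?B 2 3 p s * ?B 1 4 q t - ?B 2 4 p s * ?B 1 3 q t + ?B 3 4 p s * ?B 1 2 q t
        + (df2 A 1 q * ?w 1 p + df2 A 2 q * ?w 2 p + df2 A 3 q * ?w 3 p + df2 A 4 q * ?w 4 p)"
      if "p \<in> {1..rk2 A}" "q \<in> {1..rk2 A}" for p q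
      using that t s \<open>t \<noteq> s\<close>
      by (simp add: q322_expand wD_ssg wD_sgg wD_sss del: One_nat_def)
    show "alt2 (push3 D (\<lambda>h k. w221 [1, 2, 3, 4] (4 + k) h t s)) p q =
        alt2 (q322 wD [1, 2, 3, 4, 4 + t, 4 + s]) p q"
      using w221_d2[OF half w321 w221 args pq t s]
      unfolding alt2_def T[OF pq] T[OF pq(2,1)] push3_D[of "\<lambda>h l. ?w l h"]
      by (simp add: algebra_simps del: One_nat_def)
  qed
  ultimately show ?thesis by blast
qed

end
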